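(* Let $L$ be an integral lattice of full rank in the $n$-dimensional Euclidean space $E$ that is generated by $s$ given vectors, all of norm at most $B\in\mathbb{R}$. Then a basis of $L$ can be computed in at most $O(n^6\log^2(nB)+sn^2)$ arithmetic operations.
   Context: $E$ carries the scalar product $(\cdot,\cdot)$ and the Euclidean norm $\|x\|=\sqrt{(x,x)}$. A lattice $L$ in $E$ is integral if $(x,y)\in\mathbb{Z}$ for all $x,y\in L$; lattices have full rank, i.e. span $E$ over $\mathbb{R}$. The input is the list of the $s$ generating vectors; the running time is counted in arithmetic operations. *)

theory Defs
  imports "Jordan_Normal_Form.VS_Connect" "HOL-Algebra.AbelCoset"
begin

section \<open>Lattices in n-dimensional Euclidean space\<close>

text \<open>
  Euclidean space of dimension \<open>n\<close> is \<open>carrier_vec n\<close> over the reals with the standard scalar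
  product, that is, \<open>E\<close> in the coordinates of an orthonormal basis. The dimension is a term and
  not a type, because a single algorithm has to serve all dimensions.
\<close>

definition vnorm :: "real vec \<Rightarrow> real" where
  "vnorm x = sqrt (x \<bullet> x)"

abbreviation real_span :: "nat \<Rightarrow> real vec set \<Rightarrow> real vec set" where
  "real_span n \<equiv> LinearCombinations.module.span class_ring (module_vec TYPE(real) n)"

definition is_lattice :: "nat \<Rightarrow> real vec set \<Rightarrow> bool" where
  "is_lattice n L \<longleftrightarrow>
     additive_subgroup L (module_vec TYPE(real) n) \<and>
     (\<exists>\<epsilon>>0. \<forall>x\<in>L. x \<noteq> 0\<^sub>v n \<longrightarrow> \<epsilon> \<le> vnorm x)"

definition full_rank :: "nat \<Rightarrow> real vec set \<Rightarrow> bool" where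
  "full_rank n L \<longleftrightarrow> real_span n L = carrier_vec n"

definition integral_lattice :: "nat \<Rightarrow> real vec set \<Rightarrow> bool" where
  "integral_lattice n L \<longleftrightarrow> is_lattice n L \<and> (\<forall>x\<in>L. \<forall>y\<in>L. x \<bullet> y \<in> \<int>)"

definition int_span :: "nat \<Rightarrow> real vec list \<Rightarrow> real vec set" where
  "int_span n vs =
     {mat_of_cols n vs *\<^sub>v vec (length vs) (\<lambda>k. of_int (c k)) | c :: nat \<Rightarrow> int. True}"

definition lattice_basis :: "nat \<Rightarrow> real vec set \<Rightarrow> real vec list \<Rightarrow> bool" where
  "lattice_basis n L bs \<longleftrightarrow>
     set bs \<subseteq> carrier_vec n \<and>
     (\<forall>c\<in>carrier_vec (length bs). mat_of_cols n bs *\<^sub>v c = 0\<^sub>v n \<longrightarrow> c = 0\<^sub>v (length bs)) \<and>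
     int_span n bs = L"

section \<open>Real random access machines\<close>

text \<open>
  Exact real arithmetic, comparison and rounding at unit cost, indirect addressing of an unbounded
  memory, and programs that are independent of the dimension and of the number of input vectors.
  The constants in a program are integers, since an arbitrary real constant could encode an
  infinite amount of advice.

  There is no separate index arithmetic: indices are computed by the same real operations and
  are paid for. The data movements and the tests are counted as well. Since only boundedly many
  instructions of a program are executed between two successive tests, this changes the count of
  arithmetic operations and comparisons by at most a constant factor that depends on the program.
\<close>

datatype arith_op = Add | Sub | Mul | Div

fun apply_op :: "arith_op \<Rightarrow> real \<Rightarrow> real \<Rightarrow> real" where
  "apply_op Add x y = x + y"
| "apply_op Sub x y = x - y"
| "apply_op Mul x y = x * y"
| "apply_op Div x y = x / y"

text \<open>All arguments of type \<^typ>\<open>nat\<close> below are names of registers.\<close>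

datatype prog =
    Skip
  | Const nat int
  | Copy nat nat
  | Arith nat arith_op nat nat
  | Round_Down nat nat
  | Load nat nat
  | Store nat nat
  | Seq prog prog
  | If_Less nat nat prog prog
  | While_Less nat nat prog

text \<open>A state consists of the registers and the memory.\<close>

type_synonym state = "(nat \<Rightarrow> real) \<times> (nat \<Rightarrow> real)"

text \<open>
  \<open>exec P \<sigma> t \<tau>\<close>: started in state \<open>\<sigma>\<close>, the program \<open>P\<close> halts in state \<open>\<tau>\<close> after \<open>t\<close> operations.
  Division by zero and access to an address that is not a natural number have no rule, so
  a program that attempts them does not halt in any state.
\<close>

inductive exec :: "prog \<Rightarrow> state \<Rightarrow> nat \<Rightarrow> state \<Rightarrow> bool" where
  Skip: "exec Skip \<sigma> 0 \<sigma>"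
| Const: "exec (Const x i) (r, m) 1 (r(x := of_int i), m)"
| Copy: "exec (Copy x y) (r, m) 1 (r(x := r y), m)"
| Arith: "(f = Div \<Longrightarrow> r z \<noteq> 0) \<Longrightarrow>
    exec (Arith x f y z) (r, m) 1 (r(x := apply_op f (r y) (r z)), m)"
| Round_Down: "exec (Round_Down x y) (r, m) 1 (r(x := of_int \<lfloor>r y\<rfloor>), m)"
| Load: "r y = real a \<Longrightarrow> exec (Load x y) (r, m) 1 (r(x := m a), m)"
| Store: "r x = real a \<Longrightarrow> exec (Store x y) (r, m) 1 (r, m(a := r y))"
| Seq: "exec P \<sigma> t \<tau> \<Longrightarrow> exec Q \<tau> u \<rho> \<Longrightarrow> exec (Seq P Q) \<sigma> (t + u) \<rho>"
| If_True: "r x < r y \<Longrightarrow> exec P (r, m) t \<tau> \<Longrightarrow> exec (If_Less x y P Q) (r, m) (1 + t) \<tau>"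
| If_False: "\<not> r x < r y \<Longrightarrow> exec Q (r, m) t \<tau> \<Longrightarrow> exec (If_Less x y P Q) (r, m) (1 + t) \<tau>"
| While_True: "r x < r y \<Longrightarrow> exec P (r, m) t \<tau> \<Longrightarrow> exec (While_Less x y P) \<tau> u \<rho> \<Longrightarrow>
    exec (While_Less x y P) (r, m) (1 + t + u) \<rho>"
| While_False: "\<not> r x < r y \<Longrightarrow> exec (While_Less x y P) (r, m) 1 (r, m)"

text \<open>
  The vectors of a list are stored one after the other from address \<open>0\<close> on, each as \<open>n\<close>
  coordinates. On input, the registers \<open>0\<close> and \<open>1\<close> hold the dimension and the number of vectors,
  and everything else is \<open>0\<close>.
\<close>

definition input_state :: "nat \<Rightarrow> real vec list \<Rightarrow> state" where
  "input_state n vs =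
     ((\<lambda>_. 0)(0 := real n, 1 := real (length vs)),
      (\<lambda>a. if a < length vs * n then vs ! (a div n) $ (a mod n) else 0))"

definition outputs :: "nat \<Rightarrow> state \<Rightarrow> real vec list \<Rightarrow> bool" where
  "outputs n \<sigma> bs \<longleftrightarrow> (\<forall>k<length bs. \<forall>i<n. snd \<sigma> (k * n + i) = bs ! k $ i)"

end

theory Submission
  imports Defs
begin

text \<open>
  The program maintains a basis \<open>U\<close> of \<open>E\<close> together with its dual basis \<open>W\<close>, so that the coordinates of a
  vector \<open>X\<close> with respect to \<open>U\<close> are \<open>c = W X\<close> and cost \<open>O(n\<^sup>2)\<close> operations. If \<open>c\<^sub>p \<noteq> 0\<close>, then \<open>U\<^sub>p\<close> can be
  exchanged for \<open>X\<close> in \<open>O(n\<^sup>2)\<close> operations, and this multiplies the determinant of \<open>U\<close> by \<open>c\<^sub>p\<close>.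

  Starting from the unit vectors, \<open>n\<close> exchanges produce a basis of \<open>E\<close> that consists of generators: since the
  generators span \<open>E\<close>, none of the dual vectors is orthogonal to all of them. Its determinant is at
  most \<open>(n B)\<^sup>n\<close> in absolute value. Then the generators are inserted one by one. A vector is first reduced
  so that its coordinates are at most 1/2 in absolute value. If it does not vanish, it is exchanged for some
  \<open>U\<^sub>p\<close>, and the old \<open>U\<^sub>p\<close> is inserted in its place. Each such exchange at least halves the determinant, whose
  square is a positive integer because the lattice is integral, so there are at most \<open>n log\<^sub>2 (n B)\<close> of them.
  As there is no cost for large numbers, neither LLL reduction nor a bound on the entries of \<open>W\<close> is
  needed, and the total is \<open>O(s n\<^sup>2 + n\<^sup>3 log (n B))\<close>.
\<close>

section \<open>Weakest preconditions with running time\<close>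

text \<open>Existence of a halting run makes this total correctness: a run that divides by zero,
  uses a bad address or diverges satisfies no postcondition. The postcondition also receives the
  number of operations, so correctness and cost are proved in one pass.\<close>

definition wp where
  "wp P r m Q \<longleftrightarrow> (\<exists>t r' m'. exec P (r, m) t (r', m') \<and> Q t r' m')"

lemma wp_mono: "wp P r m Q \<Longrightarrow> (\<And>t r' m'. Q t r' m' \<Longrightarrow> R t r' m') \<Longrightarrow> wp P r m R"
  unfolding wp_def by blast

inductive_cases exec_cases:
  "exec Skip \<sigma> t \<tau>" "exec (Const x i) \<sigma> t \<tau>" "exec (Copy x y) \<sigma> t \<tau>" "exec (Arith x f y z) \<sigma> t \<tau>"
  "exec (Round_Down x y) \<sigma> t \<tau>" "exec (Load x y) \<sigma> t \<tau>" "exec (Store x y) \<sigma> t \<tau>"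
  "exec (Seq P Q) \<sigma> t \<tau>" "exec (If_Less x y P Q) \<sigma> t \<tau>"

lemma wp_simps [simp]:
  "wp Skip r m Q = Q 0 r m"
  "wp (Const x i) r m Q = Q 1 (r(x := of_int i)) m"
  "wp (Copy x y) r m Q = Q 1 (r(x := r y)) m"
  "wp (Round_Down x y) r m Q = Q 1 (r(x := of_int \<lfloor>r y\<rfloor>)) m"
  "wp (Arith x f y z) r m Q = ((f = Div \<longrightarrow> r z \<noteq> 0) \<and> Q 1 (r(x := apply_op f (r y) (r z))) m)"
  unfolding wp_def by (auto elim!: exec_cases intro!: exec.intros exI)

lemma wp_Seq [simp]: "wp (Seq P P') r m Q = wp P r m (\<lambda>t r m. wp P' r m (\<lambda>u. Q (t + u)))"
proof
  assume "wp (Seq P P') r m Q"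
  then show "wp P r m (\<lambda>t r m. wp P' r m (\<lambda>u. Q (t + u)))"
    unfolding wp_def by (metis exec_cases(8) surj_pair)
next
  assume "wp P r m (\<lambda>t r m. wp P' r m (\<lambda>u. Q (t + u)))"
  then show "wp (Seq P P') r m Q"
    unfolding wp_def by (blast intro: exec.Seq)
qed

lemma wp_If [simp]:
  "wp (If_Less x y P P') r m Q = wp (if r x < r y then P else P') r m (\<lambda>t. Q (1 + t))"
  unfolding wp_def by (cases "r x < r y")
      (auto elim!: exec_cases intro: exec.If_True[unfolded plus_1_eq_Suc] exec.If_False[unfolded plus_1_eq_Suc])

lemma wp_Load [simp]: "r y = real a \<Longrightarrow> wp (Load x y) r m Q = Q 1 (r(x := m a)) m"
  unfolding wp_def by (auto elim!: exec_cases intro!: exec.Load exI)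

lemma wp_Store [simp]: "r x = real a \<Longrightarrow> wp (Store x y) r m Q = Q 1 r (m(a := r y))"
  unfolding wp_def by (auto elim!: exec_cases intro!: exec.Store exI)

lemma wp_While_True:
  assumes "r x < r y" "wp P r m (\<lambda>t r m. wp (While_Less x y P) r m (\<lambda>u. Q (1 + t + u)))"
  shows "wp (While_Less x y P) r m Q"
  using assms unfolding wp_def by (blast intro: exec.While_True)

lemma wp_While_False:
  assumes "\<not> r x < r y" "Q 1 r m"
  shows "wp (While_Less x y P) r m Q"
  using assms unfolding wp_def by (blast intro: exec.While_False)

section \<open>Sequences and counting loops\<close>

fun block where
  "block [] = Skip"
| "block (P # Ps) = Seq P (block Ps)"

text \<open>Register 31 holds the constant 1 of the increment, so neither the counter nor its bound
  may live there.\<close>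

definition For where
  "For x y P = block [Const x 0, While_Less x y (block [P, Const 31 1, Arith x Add x 31])]"

text \<open>The invariant sees the elapsed time \<open>T\<close>, which permits amortised bounds.
  Each round adds 3 for the loop test and the two instructions of the increment; the initial 1 is
  the assignment to the counter, the final one the failing test.\<close>

lemma wp_For:
  assumes "r y = real N" "x \<noteq> 31" "y \<noteq> 31" "x \<noteq> y"
    and init: "I 0 1 (r(x := 0)) m"
    and step: "\<And>k T r m. k < N \<Longrightarrow> I k T r m \<Longrightarrow> r x = real k \<Longrightarrow> r y = real N \<Longrightarrow>
      wp P r m (\<lambda>t r m. r x = real k \<and> r y = real N \<and>
        I (Suc k) (T + t + 3) (r(31 := 1, x := real (Suc k))) m)"
    and post: "\<And>T r m. I N T r m \<Longrightarrow> r x = real N \<Longrightarrow> Q (T + 1) r m"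
  shows "wp (For x y P) r m Q"
proof -
  define W where "W = While_Less x y (block [P, Const 31 1, Arith x Add x 31])"
  have loop: "wp W r m (\<lambda>u. Q (T + u))"
    if "k \<le> N" "I k T r m" "r x = real k" "r y = real N" for k T r m
    using that
  \<comment> \<open>Induction runs downwards from \<open>N\<close>, where the loop exits, to the
    current value of the counter.\<close>
  proof (induction k arbitrary: T r m rule: inc_induct)
    case base
    then show ?case
      unfolding W_def by (auto intro!: wp_While_False post)
  next
    case (step k)
    have "wp P r m (\<lambda>t r m. r x = real k \<and> wp W (r(31 := 1, x := real (Suc k))) m (\<lambda>u. Q ((T + t + 3) + u)))"
      by (rule wp_mono[OF assms(6)[OF step(2,4,5,6)]])
          (use assms(2-4) in \<open>auto intro!: step(3) simp del: of_nat_Suc fun_upd_apply simp: fun_upd_same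
          fun_upd_other\<close>)
    then have *: "wp P r m (\<lambda>t r m. wp W (r(31 := 1, x := r x + 1)) m (\<lambda>u. Q (T + (1 + (t + 2) + u))))"
      by (elim wp_mono) (simp add: algebra_simps eval_nat_numeral)
    show ?case
      unfolding W_def
      by (rule wp_While_True) (use step(2,5,6) * assms(2-4) in \<open>simp_all add: W_def\<close>)
  qed
  have "wp W (r(x := 0)) m (\<lambda>u. Q (1 + u))"
    by (rule loop[of 0]) (use assms(1,4) init in auto)
  then show ?thesis
    by (simp add: For_def flip: W_def[unfolded block.simps])
qed

text \<open>The variant for a body of bounded cost \<open>c\<close>; every loop except the one over
  the inserted generators is counted this way.\<close>

lemma wp_For_bound:
  assumes "r y = real N" "x \<noteq> 31" "y \<noteq> 31" "x \<noteq> y"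
    and "I 0 (r(x := 0)) m"
    and step: "\<And>k r m. k < N \<Longrightarrow> I k r m \<Longrightarrow> r x = real k \<Longrightarrow> r y = real N \<Longrightarrow>
      wp P r m (\<lambda>t r m. t \<le> c \<and> r x = real k \<and> r y = real N \<and> I (Suc k) (r(31 := 1, x := real (Suc k))) m)"
    and post: "\<And>T r m. I N r m \<Longrightarrow> r x = real N \<Longrightarrow> T \<le> N * (c + 3) + 2 \<Longrightarrow> Q T r m"
  shows "wp (For x y P) r m Q"
proof (rule wp_For[where x = x and y = y and N = N and I = "\<lambda>k T r m. I k r m \<and> T \<le> k * (c + 3) + 1"])
  fix k T r m
  assume *: "k < N" "I k r m \<and> T \<le> k * (c + 3) + 1" "r x = real k" "r y = real N"
  show "wp P r m (\<lambda>t r m. r x = real k \<and> r y = real N \<and> I (Suc k) (r(31 := 1, x := real (Suc k))) m \<and>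
      T + t + 3 \<le> Suc k * (c + 3) + 1)"
    by (rule wp_mono[OF step[of k r m]]) (use * in \<open>simp_all only:\<close>, use * in simp)
next
  fix T r m
  assume "I N r m \<and> T \<le> N * (c + 3) + 1" "r x = real N"
  then show "Q (T + 1) r m"
    by (intro post) simp_all
qed (use assms(1-5) in simp_all)

section \<open>Memory layout and subprograms\<close>

text \<open>
  Four \<open>n\<close>-column arrays are interleaved behind the input: array 0 is the basis \<open>U\<close> (vectors as
  rows), 1 is the dual basis \<open>W\<close>, and the rows 0 of 2 and 3 hold the current vector \<open>X\<close> and its coordinates \<open>c\<close>.
\<close>

definition loc :: "nat \<Rightarrow> nat \<Rightarrow> nat \<Rightarrow> nat \<Rightarrow> nat \<Rightarrow> nat" where
  "loc s n a k i = s * n + (4 * (k * n + i) + a)"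

lemma index_eq_iff [simp]:
  "i < n \<Longrightarrow> i' < n \<Longrightarrow> k * n + i = k' * n + i' \<longleftrightarrow> k = k' \<and> i = i'" for i i' n k k' :: nat
  using div_mult_self3[of n i k] by (metis add.commute add_left_cancel add_0 div_less div_mult_self3 less_zeroE)

text \<open>The array number is a digit in base 4 and the column a digit in base \<open>n\<close>,
  so uniqueness of division with remainder, \<open>index_eq_iff\<close>, applies twice.\<close>

lemma loc_eq_iff [simp]:
  assumes "a < 4" "a' < 4" "i < n" "i' < n"
  shows "loc s n a k i = loc s n a' k' i' \<longleftrightarrow> a = a' \<and> k = k' \<and> i = i'"
  using index_eq_iff[OF assms(1,2), of "k * n + i" "k' * n + i'"] assms(3,4)
  by (auto simp: loc_def mult.commute)

definition Address where
  "Address a k i = block [Arith 30 Mul k 0, Arith 30 Add 30 i, Const 31 4, Arith 30 Mul 31 30,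
     Const 31 (int a), Arith 30 Add 30 31, Arith 31 Mul 1 0, Arith 30 Add 31 30]"

definition "Fetch x a k i = Seq (Address a k i) (Load x 30)"
definition "Put a k i x = Seq (Address a k i) (Store 30 x)"

text \<open>Turns a register back into a natural number, so that addresses are terms in the state
  and \<open>wp_Fetch\<close> and \<open>wp_Put\<close> can be simplification rules without free
  indices.\<close>

definition "reg r x = nat \<lfloor>r x\<rfloor>" for r :: "nat \<Rightarrow> real"

lemma reg_eq [simp]: "r x = real k \<Longrightarrow> reg r x = k"
  by (simp add: reg_def)

text \<open>The register state left by \<open>Address\<close>. Kept folded, it hides registers 30
  and 31 and lets all lower registers be read off unchanged.\<close>

definition "scratch r a k i = r(31 := r 1 * r 0, 30 := real (loc (reg r 1) (reg r 0) a (reg r k) (reg r i)))"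

lemma wp_Address:
  assumes regs: "r 0 \<in> \<nat>" "r 1 \<in> \<nat>" "r k \<in> \<nat>" "r i \<in> \<nat>" and "i < 30" "k < 30"
  shows "wp (Address a k i) r m Q = Q 8 (scratch r a k i) m"
proof -
  obtain n s K I where "r 0 = real n" "r 1 = real s" "r k = real K" "r i = real I"
    using regs by (auto simp: Nats_def)
  then show ?thesis
    using assms(5,6) by (simp add: Address_def scratch_def loc_def fun_upd_twist) (simp add: eval_nat_numeral)
qed

lemma wp_Fetch [simp]:
  assumes "r 0 \<in> \<nat>" "r 1 \<in> \<nat>" "r k \<in> \<nat>" "r i \<in> \<nat>" "i < 30" "k < 30"
  shows "wp (Fetch x a k i) r m Q =
    Q 9 ((scratch r a k i)(x := m (loc (reg r 1) (reg r 0) a (reg r k) (reg r i)))) m"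
  using assms by (simp add: Fetch_def wp_Address) (simp add: scratch_def)

lemma wp_Put [simp]:
  assumes "r 0 \<in> \<nat>" "r 1 \<in> \<nat>" "r k \<in> \<nat>" "r i \<in> \<nat>" "i < 30" "k < 30" "x < 30"
  shows "wp (Put a k i x) r m Q =
    Q 9 (scratch r a k i) (m(loc (reg r 1) (reg r 0) a (reg r k) (reg r i) := r x))"
  using assms by (simp add: Put_def wp_Address) (simp add: scratch_def)

lemma scratch_apply [simp]: "x < 30 \<Longrightarrow> scratch r a k i x = r x"
  by (simp add: scratch_def)

text \<open>Columns are bounded but the row index \<open>k\<close> is not: \<open>U\<close> and
  \<open>W\<close> describe the whole of their arrays, including rows beyond \<open>n\<close>, so
  that an assignment is a plain function update.\<close>

definition rep where
  "rep s n inp U W X c m \<longleftrightarrow> (\<forall>a<s * n. m a = inp a) \<and>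
     (\<forall>i<n. (\<forall>k. m (loc s n 0 k i) = U k i \<and> m (loc s n 1 k i) = W k i) \<and>
       m (loc s n 2 0 i) = X i \<and> m (loc s n 3 0 i) = c i)"
  for U W :: "nat \<Rightarrow> nat \<Rightarrow> real" and X c :: "nat \<Rightarrow> real"

lemma rep_access:
  assumes "rep s n inp U W X c m"
  shows "a < s * n \<Longrightarrow> m a = inp a"
    "i < n \<Longrightarrow> m (loc s n 0 k i) = U k i"
    "i < n \<Longrightarrow> m (loc s n (Suc 0) k i) = W k i"
    "i < n \<Longrightarrow> m (loc s n 2 0 i) = X i"
    "i < n \<Longrightarrow> m (loc s n 3 0 i) = c i"
  using assms by (simp_all add: rep_def)

lemma loc_ge [simp]: "a < s * n \<Longrightarrow> loc s n b k i \<noteq> a" "a < s * n \<Longrightarrow> a \<noteq> loc s n b k i"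
  by (simp_all add: loc_def)

lemma rep_update:
  assumes "rep s n inp U W X c m" "i < n"
  shows "rep s n inp (U(k := (U k)(i := v))) W X c (m(loc s n 0 k i := v))"
    "rep s n inp U (W(k := (W k)(i := v))) X c (m(loc s n (Suc 0) k i := v))"
    "rep s n inp U W (X(i := v)) c (m(loc s n 2 0 i := v))"
    "rep s n inp U W X (c(i := v)) (m(loc s n 3 0 i := v))"
  using assms by (simp_all add: rep_def)

text \<open>
  Outer loops use the registers 10 to 13, inner loops those from 20 on, and registers 30 and 31 are
  scratch, so that the frame of a subprogram is an initial segment of the registers.
\<close>

definition "agree l r r' \<longleftrightarrow> (\<forall>x<l. r' x = r x)"
  for r r' :: "nat \<Rightarrow> real"

lemma agree_simps [simp]: "agree l r r"
  "l \<le> x \<Longrightarrow> agree l r (r'(x := v)) = agree l r r'"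
  "l \<le> 30 \<Longrightarrow> agree l r (scratch r' a k i) = agree l r r'"
  by (auto simp: agree_def scratch_def)

lemma agree_trans: "agree l r r' \<Longrightarrow> agree l' r' r'' \<Longrightarrow> l \<le> l' \<Longrightarrow> agree l r r''"
  by (simp add: agree_def)

text \<open>Loop invariants describe a half-processed vector by such a case distinction; one
  assignment turns it into that of the next round.\<close>

lemma fun_upd_upto [simp]:
  "v = f k \<Longrightarrow> (\<lambda>i. if i < k then f i else g i)(k := v) = (\<lambda>i. if i < Suc k then f i else g i)"
  by (auto simp: less_Suc_eq)

lemma rep_cong:
  assumes "rep s n inp U W X c m"
    and "\<And>k i. i < n \<Longrightarrow> U k i = U' k i" "\<And>k i. i < n \<Longrightarrow> W k i = W' k i"
    "\<And>i. i < n \<Longrightarrow> X i = X' i" "\<And>i. i < n \<Longrightarrow> c i = c' i"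
  shows "rep s n inp U' W' X' c' m"
  using assms by (simp add: rep_def)

definition "sizes s n r \<longleftrightarrow> r 0 = real n \<and> r (Suc 0) = real s"

lemma sizesD: "sizes s n r \<Longrightarrow> r 0 = real n"  "sizes s n r \<Longrightarrow> r (Suc 0) = real s"
  by (simp_all add: sizes_def)

lemma agree_sizes: "sizes s n r \<Longrightarrow> agree l r r' \<Longrightarrow> 2 \<le> l \<Longrightarrow> sizes s n r'"
  by (auto simp: agree_def sizes_def)

section \<open>Coordinates as products with the dual basis\<close>

definition "Dot x = For 25 0 (block
  [Fetch 26 1 x 25, Fetch 27 2 22 25, Arith 26 Mul 26 27, Arith 24 Add 24 26])"

definition mult_vec :: "nat \<Rightarrow> (nat \<Rightarrow> nat \<Rightarrow> real) \<Rightarrow> (nat \<Rightarrow> real) \<Rightarrow> nat \<Rightarrow> real" where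
  "mult_vec n W X k = (\<Sum>i<n. W k i * X i)"

text \<open>\<open>Dot\<close> accumulates in register 24, cleared beforehand by the caller, and
  register 22 supplies 0 as the row number of the current vector.\<close>

lemma wp_Dot:
  assumes "sizes s n r" "rep s n inp U W X c m" "r x = real k" "x < 24" "r 22 = 0" "r 24 = 0"
  shows "wp (Dot x) r m (\<lambda>t r' m'. t \<le> n * 23 + 2 \<and> agree 24 r r' \<and> r' 24 = mult_vec n W X k \<and> m' = m)"
  unfolding Dot_def
proof (rule wp_For_bound[where c = 20 and N = n and I = "\<lambda>i r' m'. agree 24 r r' \<and>
      r' 24 = (\<Sum>j<i. W k j * X j) \<and> m' = m"])
  fix i r' m'
  assume i: "i < n" "agree 24 r r' \<and> r' 24 = (\<Sum>j<i. W k j * X j) \<and> m' = m"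
    "r' 25 = real i" "r' 0 = real n"
  have "sizes s n r'" "r' x = real k" "r' 22 = 0"
    using i assms agree_sizes[of s n r 24 r'] by (auto simp: agree_def)
  note [simp] = sizesD[OF this(1)] this(2,3) rep_access[OF assms(2)]
  show "wp (block [Fetch 26 1 x 25, Fetch 27 2 22 25, Arith 26 Mul 26 27, Arith 24 Add 24 26]) r' m'
     (\<lambda>t r' m'. t \<le> 20 \<and> r' 25 = real i \<and> r' 0 = real n \<and>
       agree 24 r (r'(31 := 1, 25 := real (Suc i))) \<and>
       (r'(31 := 1, 25 := real (Suc i))) 24 = (\<Sum>j<Suc i. W k j * X j) \<and> m' = m)"
    using i \<open>x < 24\<close> by simp
qed (use assms in \<open>auto simp: mult_vec_def sizes_def\<close>)

definition "Matvec = For 20 0 (block [Const 22 0, Const 24 0, Dot 20, Put 3 22 20 24])"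

lemma wp_Matvec:
  assumes "sizes s n r" "rep s n inp U W X c m"
  shows "wp Matvec r m (\<lambda>t r' m'. t \<le> n * (n * 23 + 16) + 2 \<and> agree 20 r r' \<and>
    rep s n inp U W X (mult_vec n W X) m')"
  unfolding Matvec_def
proof (rule wp_For_bound[where c = "n * 23 + 13" and N = n and I = "\<lambda>k r' m'. agree 20 r r' \<and>
    rep s n inp U W X (\<lambda>i. if i < k then mult_vec n W X i else c i) m'"])
  fix k r' m'
  assume k: "k < n" "agree 20 r r' \<and> rep s n inp U W X (\<lambda>i. if i < k then mult_vec n W X i else c i) m'"
    "r' 20 = real k" "r' 0 = real n"
  have r': "sizes s n r'"
    using k assms agree_sizes[of s n r 20 r'] by auto
  have "wp (Dot 20) (r'(22 := 0, 24 := 0)) m' (\<lambda>t r'' m''. t \<le> n * 23 + 2 \<and>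
      agree 24 (r'(22 := 0, 24 := 0)) r'' \<and> r'' 24 = mult_vec n W X k \<and> m'' = m')"
    by (rule wp_Dot) (use r' k in \<open>auto simp: sizes_def\<close>)
  then show "wp (block [Const 22 0, Const 24 0, Dot 20, Put 3 22 20 24]) r' m' (\<lambda>t r' m'.
      t \<le> n * 23 + 13 \<and> r' 20 = real k \<and> r' 0 = real n \<and> agree 20 r (r'(31 := 1, 20 := real (Suc k))) \<and>
      rep s n inp U W X (\<lambda>i. if i < Suc k then mult_vec n W X i else c i) m')"
    apply simp
    apply (erule wp_mono)
    subgoal for t r'' m''
      using k(1,3) r' k(2)[THEN conjunct1] rep_update(4)[OF conjunct2[OF k(2)] k(1), of "mult_vec n W X k"]
      by (auto simp: agree_def sizes_def)
    done
qed (use assms in \<open>auto simp: sizes_def algebra_simps elim!: rep_cong\<close>)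

section \<open>Exchange of a basis vector\<close>

definition "Eliminate = For 25 0 (block [Fetch 26 1 25 20, Fetch 27 3 22 25, Arith 27 Mul 27 23,
   Arith 26 Sub 26 27, Put 1 25 20 26])"

text \<open>One column of the pivot step, with the new pivot entry in register 23. The pivot row is
  treated like all others and thereby spoilt; \<open>Exchange\<close> writes register 23 into it
  right afterwards.\<close>

lemma wp_Eliminate:
  assumes "sizes s n r" "rep s n inp U W X c m" "r 20 = real l" "l < n" "r 22 = 0"
  shows "wp Eliminate r m (\<lambda>t r' m'. t \<le> n * 32 + 2 \<and> agree 25 r r' \<and>
    rep s n inp U (\<lambda>k i. if i = l \<and> k < n then W k i - c k * r 23 else W k i) X c m')"
  unfolding Eliminate_def
proof (rule wp_For_bound[where c = 29 and N = n and I = "\<lambda>k' r' m'. agree 25 r r' \<and>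
    rep s n inp U (\<lambda>k i. if i = l \<and> k < k' then W k i - c k * r 23 else W k i) X c m'"])
  fix k r' m'
  assume k: "k < n" "agree 25 r r' \<and>
      rep s n inp U (\<lambda>k' i. if i = l \<and> k' < k then W k' i - c k' * r 23 else W k' i) X c m'"
    "r' 25 = real k" "r' 0 = real n"
  have "sizes s n r'" "r' 20 = real l" "r' 22 = 0" "r' 23 = r 23"
    using k assms agree_sizes[of s n r 25 r'] by (auto simp: agree_def)
  note [simp] = sizesD[OF this(1)] this(2-4) rep_access[OF conjunct2[OF k(2)]]
  have "rep s n inp U (\<lambda>k' i. if i = l \<and> k' < Suc k then W k' i - c k' * r 23 else W k' i) X c
    (m'(loc s n (Suc 0) k l := W k l - c k * r 23))"
    by (rule rep_cong[OF rep_update(2)[OF conjunct2[OF k(2)]]]) (use assms in auto)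
  then show "wp (block [Fetch 26 1 25 20, Fetch 27 3 22 25, Arith 27 Mul 27 23,
   Arith 26 Sub 26 27, Put 1 25 20 26]) r' m' (\<lambda>t r' m'.
      t \<le> 29 \<and> r' 25 = real k \<and> r' 0 = real n \<and> agree 25 r (r'(31 := 1, 25 := real (Suc k))) \<and>
      rep s n inp U (\<lambda>k' i. if i = l \<and> k' < Suc k then W k' i - c k' * r 23 else W k' i) X c m')"
    using k assms(4) by simp
qed (use assms in \<open>auto simp: sizes_def algebra_simps elim!: rep_cong\<close>)

definition "Exchange p = For 20 0 (block [Const 22 0, Fetch 23 1 p 20, Fetch 24 3 22 p, Arith 23 Div 23 24,
  Eliminate, Put 1 p 20 23, Fetch 23 0 p 20, Fetch 24 2 22 20, Put 0 p 20 24, Put 2 22 20 23])"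

text \<open>A Gauss-Jordan step: the dual basis after \<open>U p\<close> has been replaced by a
  vector with coordinates \<open>c\<close>. The last case reflects that the program leaves the rows
  from \<open>n\<close> on alone.\<close>

definition pivot :: "nat \<Rightarrow> nat \<Rightarrow> (nat \<Rightarrow> real) \<Rightarrow> (nat \<Rightarrow> nat \<Rightarrow> real) \<Rightarrow> nat \<Rightarrow> nat \<Rightarrow> real" where
  "pivot n p c W k i = (if k = p then W p i / c p else if k < n then W k i - c k * (W p i / c p) else W k i)"

text \<open>\<open>U P\<close> and the current vector trade places. The columns can be processed one
  by one because \<open>c\<close> does not change meanwhile; afterwards it is stale until
  \<open>Matvec\<close> runs again.\<close>

lemma wp_Exchange:
  assumes "sizes s n r" "rep s n inp U W X c m" "r p = real P" "P < n" "p < 20" "c P \<noteq> 0"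
  shows "wp (Exchange p) r m (\<lambda>t r' m'. t \<le> n * (n * 32 + 70) + 2 \<and> agree 20 r r' \<and>
    rep s n inp (U(P := X)) (pivot n P c W) (U P) c m')"
  unfolding Exchange_def
proof (rule wp_For_bound[where c = "n * 32 + 67" and N = n and I = "\<lambda>l r' m'. agree 20 r r' \<and>
    rep s n inp (\<lambda>k i. if k = P \<and> i < l then X i else U k i) (\<lambda>k i. if i < l then pivot n P c W k i else W k i)
      (\<lambda>i. if i < l then U P i else X i) c m'"])
  fix l r' m'
  assume l: "l < n" "agree 20 r r' \<and> rep s n inp (\<lambda>k i. if k = P \<and> i < l then X i else U k i)
    (\<lambda>k i. if i < l then pivot n P c W k i else W k i) (\<lambda>i. if i < l then U P i else X i) c m'"
    "r' 20 = real l" "r' 0 = real n"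
  have r': "sizes s n r'" "r' p = real P"
    using l assms agree_sizes[of s n r 20 r'] by (auto simp: agree_def)
  note [simp] = sizesD[OF r'(1)] r'(2) rep_access[OF conjunct2[OF l(2)]]
  show "wp (block [Const 22 0, Fetch 23 1 p 20, Fetch 24 3 22 p, Arith 23 Div 23 24,
    Eliminate, Put 1 p 20 23, Fetch 23 0 p 20, Fetch 24 2 22 20, Put 0 p 20 24,
        Put 2 22 20 23]) r' m' (\<lambda>t r' m'.
      t \<le> n * 32 + 67 \<and> r' 20 = real l \<and> r' 0 = real n \<and> agree 20 r (r'(31 := 1, 20 := real (Suc l))) \<and>
      rep s n inp (\<lambda>k i. if k = P \<and> i < Suc l then X i else U k i) (\<lambda>k i.
          if i < Suc l then pivot n P c W k i else W k i)
      (\<lambda>i. if i < Suc l then U P i else X i) c m')"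
    using l assms
    apply simp
    apply (rule wp_mono[OF wp_Eliminate[OF _ conjunct2[OF l(2)], of _ l]])
        apply (simp_all add: sizes_def)
    apply (elim conjE)
    subgoal premises prems for t r'' m''
    proof -
      have "r'' p = real P" "r'' 20 = real l" "r'' 0 = real n" "r'' (Suc 0) = real s" "r'' 22 = 0"
        "r'' 23 = W P l / c P" "agree 20 r r''"
        using prems by (auto simp: agree_def)
      note [simp] = this rep_access[OF prems(14)]
      have "rep s n inp (\<lambda>k i. if k = P \<and> i < Suc l then X i else U k i)
        (\<lambda>k i. if i < Suc l then pivot n P c W k i else W k i) (\<lambda>i. if i < Suc l then U P i else X i) c
        (m''(loc s n (Suc 0) P l := W P l / c P, loc s n 0 P l := X l, loc s n 2 0 l := U P l))"
        by (rule rep_cong[OF rep_update(3)[OF rep_update(1)[OF rep_update(2)[OF prems(14)]]]])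
          (use prems in \<open>auto simp: less_Suc_eq pivot_def\<close>)
      then show ?thesis
        using prems by simp
    qed
    done
next
  fix T r' m'
  assume "agree 20 r r' \<and> rep s n inp (\<lambda>k i. if k = P \<and> i < n then X i else U k i)
    (\<lambda>k i. if i < n then pivot n P c W k i else W k i) (\<lambda>i. if i < n then U P i else X i) c m'"
    "T \<le> n * (n * 32 + 67 + 3) + 2"
  then show "T \<le> n * (n * 32 + 70) + 2 \<and> agree 20 r r' \<and>
    rep s n inp (U(P := X)) (pivot n P c W) (U P) c m'"
    by (auto simp: algebra_simps elim!: rep_cong)
qed (use assms in \<open>auto simp: sizes_def algebra_simps elim!: rep_cong\<close>)

section \<open>Reduction modulo the basis\<close>

definition "Subtract = For 25 0 (block [Fetch 26 0 20 25, Arith 26 Mul 26 24, Fetch 27 2 22 25,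
   Arith 27 Sub 27 26, Put 2 22 25 27])"

lemma wp_Subtract:
  assumes "sizes s n r" "rep s n inp U W X c m" "r 20 = real k" "r 22 = 0"
  shows "wp Subtract r m (\<lambda>t r' m'. t \<le> n * 32 + 2 \<and> agree 25 r r' \<and>
    rep s n inp U W (\<lambda>i. X i - U k i * r 24) c m')"
  unfolding Subtract_def
proof (rule wp_For_bound[where c = 29 and N = n and I = "\<lambda>l r' m'. agree 25 r r' \<and>
    rep s n inp U W (\<lambda>i. if i < l then X i - U k i * r 24 else X i) c m'"])
  fix l r' m'
  assume l: "l < n" "agree 25 r r' \<and>
      rep s n inp U W (\<lambda>i. if i < l then X i - U k i * r 24 else X i) c m'"
    "r' 25 = real l" "r' 0 = real n"
  have "sizes s n r'" "r' 20 = real k" "r' 22 = 0" "r' 24 = r 24"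
    using l assms agree_sizes[of s n r 25 r'] by (auto simp: agree_def)
  note [simp] = sizesD[OF this(1)] this(2-4) rep_access[OF conjunct2[OF l(2)]]
  show "wp (block [Fetch 26 0 20 25, Arith 26 Mul 26 24, Fetch 27 2 22 25,
      Arith 27 Sub 27 26, Put 2 22 25 27]) r' m' (\<lambda>t r' m'.
      t \<le> 29 \<and> r' 25 = real l \<and> r' 0 = real n \<and> agree 25 r (r'(31 := 1, 25 := real (Suc l))) \<and>
      rep s n inp U W (\<lambda>i. if i < Suc l then X i - U k i * r 24 else X i) c m')"
    using l rep_update(3)[OF conjunct2[OF l(2)] l(1), of "X l - U k l * r 24"] by simp
qed (use assms in \<open>auto simp: sizes_def algebra_simps elim!: rep_cong\<close>)

definition nearest :: "real \<Rightarrow> int" where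
  "nearest x = \<lfloor>1 / 2 + x\<rfloor>"

text \<open>Register 13 starts as \<open>n\<close>, the mark of a vector reduced to zero, and
  otherwise ends as the index of a nonzero remaining coordinate. As the machine only tests
  \<open><\<close>, a coordinate is recognised as nonzero by its positive square; 1/2 is produced by
  division because constants are integers.\<close>

definition "Reduce = Seq (Copy 13 0) (For 20 0 (block [Const 22 0, Fetch 23 3 22 20, Const 24 1, Const 21 2,
  Arith 24 Div 24 21, Arith 24 Add 24 23, Round_Down 24 24, Arith 23 Sub 23 24, Put 3 22 20 23, Subtract,
  Arith 23 Mul 23 23, If_Less 22 23 (Copy 13 20) Skip]))"

text \<open>The coordinates are updated in place together with the vector. That they stay its
  coordinates for a dual pair is \<open>mult_vec_reduce\<close>.\<close>

lemma wp_Reduce: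
  assumes "sizes s n r" "rep s n inp U W X c m"
  shows "wp Reduce r m (\<lambda>t r' m'. t \<le> n * (n * 32 + 33) + 3 \<and> agree 13 r r' \<and>
    rep s n inp U W (\<lambda>i. X i - (\<Sum>k<n. U k i * nearest (c k))) (\<lambda>k. c k - nearest (c k)) m' \<and>
    (\<exists>p. r' 13 = real p \<and> (p < n \<and> c p \<noteq> nearest (c p) \<or> p = n \<and> (\<forall>k<n. c k = nearest (c k)))))"
proof -
  have "wp (For 20 0 (block [Const 22 0, Fetch 23 3 22 20, Const 24 1, Const 21 2,
    Arith 24 Div 24 21, Arith 24 Add 24 23, Round_Down 24 24, Arith 23 Sub 23 24, Put 3 22 20 23, Subtract,
    Arith 23 Mul 23 23, If_Less 22 23 (Copy 13 20) Skip])) (r(13 := real n)) m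
    (\<lambda>t r' m'. t \<le> n * (n * 32 + 33) + 2 \<and> agree 13 r r' \<and>
    rep s n inp U W (\<lambda>i. X i - (\<Sum>k<n. U k i * nearest (c k))) (\<lambda>k. c k - nearest (c k)) m' \<and>
    (\<exists>p. r' 13 = real p \<and> (p < n \<and> c p \<noteq> nearest (c p) \<or> p = n \<and> (\<forall>k<n. c k = nearest (c k)))))"
  proof (rule wp_For_bound[where c = "n * 32 + 30" and N = n and I = "\<lambda>k r' m'. agree 13 r r' \<and>
      rep s n inp U W (\<lambda>i. X i - (\<Sum>j<k. U j i * nearest (c j))) (\<lambda>j.
          if j < k then c j - nearest (c j) else c j) m' \<and>
      (\<exists>p. r' 13 = real p \<and> (p < n \<and> c p \<noteq> nearest (c p) \<or> p = n \<and> (\<forall>j<k. c j = nearest (c j))))"])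
    fix k r' m'
    assume k: "k < n" "agree 13 r r' \<and>
      rep s n inp U W (\<lambda>i. X i - (\<Sum>j<k. U j i * nearest (c j))) (\<lambda>j.
          if j < k then c j - nearest (c j) else c j) m' \<and>
      (\<exists>p. r' 13 = real p \<and> (p < n \<and> c p \<noteq> nearest (c p) \<or> p = n \<and> (\<forall>j<k. c j = nearest (c j))))"
      "r' 20 = real k" "r' 0 = real n"
    note rep = conjunct1[OF conjunct2[OF k(2)]]
    have r': "sizes s n r'"
      using k assms agree_sizes[of s n r 13 r'] by (auto simp: agree_def)
    note [simp] = sizesD[OF r'] rep_access[OF rep]
    obtain p where p: "r' 13 = real p" "p < n \<and> c p \<noteq> nearest (c p) \<or> p = n \<and> (\<forall>j<k. c j = nearest (c j))"
      using k(2) by blast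
    show "wp (block [Const 22 0, Fetch 23 3 22 20, Const 24 1, Const 21 2,
    Arith 24 Div 24 21, Arith 24 Add 24 23, Round_Down 24 24, Arith 23 Sub 23 24, Put 3 22 20 23, Subtract,
    Arith 23 Mul 23 23, If_Less 22 23 (Copy 13 20) Skip]) r' m' (\<lambda>t r' m'. t \<le> n * 32 + 30 \<and>
      r' 20 = real k \<and> r' 0 = real n \<and> agree 13 r (r'(31 := 1, 20 := real (Suc k))) \<and>
      rep s n inp U W (\<lambda>i. X i - (\<Sum>j<Suc k. U j i * nearest (c j))) (\<lambda>j.
          if j < Suc k then c j - nearest (c j) else c j) m' \<and>
      (\<exists>p. (r'(31 := 1, 20 := real (Suc k))) 13 = real p \<and>
        (p < n \<and> c p \<noteq> nearest (c p) \<or> p = n \<and> (\<forall>j<Suc k. c j = nearest (c j)))))"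
      using k p
      apply (simp flip: nearest_def)
      apply (rule wp_mono[OF wp_Subtract[OF _ rep_update(4)[OF rep], of _ _ k]])
          apply (simp_all add: sizes_def)
      apply (elim conjE)
      subgoal premises prems for t r'' m''
      proof -
        have "r'' 20 = real k" "r'' 0 = real n" "r'' 13 = real p" "r'' 22 = 0"
          "r'' 23 = c k - nearest (c k)" "agree 13 r r''"
          using prems by (auto simp: agree_def)
        note [simp] = this
        have "0 < (c k - nearest (c k)) * (c k - nearest (c k)) \<longleftrightarrow> c k \<noteq> nearest (c k)"
          by (simp add: zero_less_mult_iff) linarith
        moreover have "(\<exists>p'. real p = real p' \<and> (p' < n \<and> c p' \<noteq> nearest (c p') \<or>
            p' = n \<and> (\<forall>j<Suc k. c j = nearest (c j))))" if "c k = nearest (c k)"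
          using prems(4) that by (auto simp: less_Suc_eq)
        ultimately show ?thesis
          using prems by (auto simp: diff_diff_eq)
      qed
      done
  qed (use assms in \<open>auto simp: sizes_def algebra_simps elim!: rep_cong\<close>)
  then show ?thesis
    using sizesD[OF assms(1)] by (auto simp: Reduce_def elim!: wp_mono)
qed

definition "Copy_Input j = For 20 0 (block [Arith 21 Mul j 0, Arith 21 Add 21 20, Load 21 21, Const 22 0,
  Put 2 22 20 21])"

lemma less_mult_add: "j < s \<Longrightarrow> i < n \<Longrightarrow> j * n + i < s * n" for i j n s :: nat
  using mult_le_mono1[of "Suc j" s n] by simp

lemma wp_Copy_Input:
  assumes "sizes s n r" "rep s n inp U W X c m" "r j = real J" "J < s" "j < 20"
  shows "wp (Copy_Input j) r m (\<lambda>t r' m'. t \<le> n * 16 + 2 \<and> agree 20 r r' \<and>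
    rep s n inp U W (\<lambda>i. inp (J * n + i)) c m')"
  unfolding Copy_Input_def
proof (rule wp_For_bound[where c = 13 and N = n and I = "\<lambda>k r' m'. agree 20 r r' \<and>
    rep s n inp U W (\<lambda>i. if i < k then inp (J * n + i) else X i) c m'"])
  fix k r' m'
  assume k: "k < n" "agree 20 r r' \<and> rep s n inp U W (\<lambda>i. if i < k then inp (J * n + i) else X i) c m'"
    "r' 20 = real k" "r' 0 = real n"
  have r': "sizes s n r'" "r' j = real J"
    using k assms agree_sizes[of s n r 20 r'] by (auto simp: agree_def)
  have [simp]: "m' (J * n + k) = inp (J * n + k)"
    using rep_access(1)[OF conjunct2[OF k(2)]] less_mult_add k assms(4) by blast
  note [simp] = sizesD[OF r'(1)] r'(2) wp_Load[where a = "J * n + k"]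
  show "wp (block [Arith 21 Mul j 0, Arith 21 Add 21 20, Load 21 21, Const 22 0,
  Put 2 22 20 21]) r' m' (\<lambda>t r' m'. t \<le> 13 \<and> r' 20 = real k \<and> r' 0 = real n \<and> agree 20 r (r'(31 := 1, 20 :=
      real (Suc k))) \<and>
      rep s n inp U W (\<lambda>i. if i < Suc k then inp (J * n + i) else X i) c m')"
    using k rep_update(3)[OF conjunct2[OF k(2)] k(1), of "inp (J * n + k)"] assms(5) by simp
qed (use assms in \<open>auto simp: sizes_def algebra_simps elim!: rep_cong\<close>)

section \<open>Dual bases and determinants\<close>

definition dual :: "nat \<Rightarrow> (nat \<Rightarrow> nat \<Rightarrow> real) \<Rightarrow> (nat \<Rightarrow> nat \<Rightarrow> real) \<Rightarrow> bool" where
  "dual n U W \<longleftrightarrow> (\<forall>k<n. \<forall>l<n. mult_vec n W (U l) k = (if k = l then 1 else 0))"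

lemma mult_vec_pivot:
  assumes "k < n"
  shows "mult_vec n (pivot n p c W) Y k =
    (if k = p then mult_vec n W Y p / c p else mult_vec n W Y k - c k * (mult_vec n W Y p / c p))"
  using assms
  by (simp add: mult_vec_def pivot_def sum_divide_distrib sum_distrib_left left_diff_distrib sum_subtractf
      mult.assoc)

text \<open>For k different from p, subtracting c_k / c_p times row p annihilates X, and it changes
  no product with \<open>U l\<close> for l different from p because row p is orthogonal to those.
  Row p itself is only scaled.\<close>

lemma dual_pivot:
  assumes "dual n U W" "p < n" "mult_vec n W X p \<noteq> 0"
  shows "dual n (U(p := X)) (pivot n p (mult_vec n W X) W)"
  using assms by (auto simp: dual_def mult_vec_pivot)

definition col_mat :: "nat \<Rightarrow> (nat \<Rightarrow> nat \<Rightarrow> real) \<Rightarrow> real mat" where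
  "col_mat n U = mat n n (\<lambda>(i, k). U k i)"

lemma dim_col_mat [simp]: "dim_row (col_mat n U) = n" "dim_col (col_mat n U) = n"
  by (simp_all add: col_mat_def)

lemma col_mat_carrier [simp]: "col_mat n U \<in> carrier_mat n n"
  by (simp add: col_mat_def)

lemma col_mat_index [simp]: "i < n \<Longrightarrow> k < n \<Longrightarrow> col_mat n U $$ (i, k) = U k i"
  by (simp add: col_mat_def)

lemma dual_iff: "dual n U W \<longleftrightarrow> transpose_mat (col_mat n W) * col_mat n U = 1\<^sub>m n"
  by (auto simp: dual_def mult_vec_def mat_eq_iff scalar_prod_def lessThan_atLeast0)

text \<open>A left inverse of a square matrix is also a right inverse; hence W X really consists of
  the coordinates of X with respect to U.\<close>

lemma dual_expand:
  assumes "dual n U W" "i < n"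
  shows "(\<Sum>k<n. U k i * mult_vec n W X k) = X i"
proof -
  have "col_mat n U * transpose_mat (col_mat n W) = 1\<^sub>m n"
    using assms(1) unfolding dual_iff by (rule mat_mult_left_right_inverse[rotated 2]) auto
  then have "(col_mat n U * transpose_mat (col_mat n W)) *\<^sub>v vec n X = vec n X"
    by simp
  then have "(col_mat n U *\<^sub>v (transpose_mat (col_mat n W) *\<^sub>v vec n X)) $ i = vec n X $ i"
    by (subst (asm) assoc_mult_mat_vec) auto
  then show ?thesis
    using assms(2) by (simp add: scalar_prod_def mult_vec_def lessThan_atLeast0)
qed

text \<open>Cramer's rule read backwards, with W X as the solution c of the linear system U c =
  X.\<close>

lemma det_exchange:
  assumes "dual n U W" "p < n"
  shows "det (col_mat n (U(p := X))) = mult_vec n W X p * det (col_mat n U)"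
proof -
  have "col_mat n U *\<^sub>v vec n (mult_vec n W X) = vec n X"
    using dual_expand[OF assms(1)] by (auto simp: vec_eq_iff scalar_prod_def lessThan_atLeast0)
  then have "replace_col (col_mat n U) (col_mat n U *\<^sub>v vec n (mult_vec n W X)) p = col_mat n (U(p := X))"
    using assms(2) by (auto simp: replace_col_def mat_eq_iff)
  then show ?thesis
    using cramer_lemma_mat[of "col_mat n U" n "vec n (mult_vec n W X)" p] assms(2) by simp
qed

section \<open>Lower and upper bounds for the determinant\<close>

lemma det_Ints:
  assumes "A \<in> carrier_mat n n" "\<And>i j. i < n \<Longrightarrow> j < n \<Longrightarrow> A $$ (i, j) \<in> \<int>"
  shows "det A \<in> \<int>"
proof -
  have "p i < n" if "p permutes {0..<n}" "i < n" for p i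
    using permutes_in_image[OF that(1), of i] that(2) by simp
  with assms(2) show ?thesis
    unfolding det_def'[OF assms(1)] by (intro Ints_sum Ints_mult Ints_prod) auto
qed

text \<open>The Gram determinant is the square of the determinant; it is an integer, and nonzero
  because U is invertible.\<close>

lemma abs_det_ge_1:
  assumes "dual n U W" "\<And>k l. k < n \<Longrightarrow> l < n \<Longrightarrow> (\<Sum>i<n. U k i * U l i) \<in> \<int>"
  shows "1 \<le> \<bar>det (col_mat n U)\<bar>"
proof -
  let ?A = "col_mat n U"
  have "det (transpose_mat (col_mat n W)) * det ?A = 1"
    using det_mult[of "transpose_mat (col_mat n W)" n ?A] assms(1)[unfolded dual_iff] by simp
  then have nz: "det ?A \<noteq> 0"
    by auto
  have "det (transpose_mat ?A * ?A) \<in> \<int>"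
    using assms(2) by (intro det_Ints[of _ n]) (auto simp: scalar_prod_def lessThan_atLeast0)
  also have "det (transpose_mat ?A * ?A) = (det ?A)\<^sup>2"
    by (simp add: det_mult[of _ n] det_transpose[of _ n] power2_eq_square)
  finally have "1 \<le> (det ?A)\<^sup>2"
    using nz Ints_nonzero_abs_ge1[of "(det ?A)\<^sup>2"] by simp
  then show ?thesis
    by (simp add: abs_le_square_iff[of 1, simplified])
qed

text \<open>The Leibniz formula has n! \<le> n^n terms of size at most B^n. Hadamard's inequality
  would be sharper, but only the logarithm enters the running time.\<close>

lemma abs_det_le:
  assumes "\<And>k i. k < n \<Longrightarrow> i < n \<Longrightarrow> \<bar>U k i\<bar> \<le> B"
  shows "\<bar>det (col_mat n U)\<bar> \<le> (real n * B) ^ n"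
proof -
  have "\<bar>det (col_mat n U)\<bar> \<le> (\<Sum>p | p permutes {0..<n}. \<bar>signof p * (\<Prod>i = 0..<n. col_mat n U $$ (i, p i))\<bar>)"
    unfolding det_def'[OF col_mat_carrier] by (rule sum_abs)
  also have "\<dots> \<le> (\<Sum>p | p permutes {0..<n}. B ^ n)"
  proof (rule sum_mono)
    fix p assume "p \<in> {p. p permutes {0..<n}}"
    then have "p i < n" if "i < n" for i
      using permutes_in_image[of p "{0..<n}" i] that by simp
    then have "\<bar>\<Prod>i = 0..<n. col_mat n U $$ (i, p i)\<bar> \<le> (\<Prod>i = 0..<n. B)"
      unfolding abs_prod using assms by (intro prod_mono) auto
    moreover have "\<bar>signof p\<bar> = (1 :: real)"
      by (simp add: sign_def)
    ultimately show "\<bar>signof p * (\<Prod>i = 0..<n. col_mat n U $$ (i, p i))\<bar> \<le> B ^ n"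
      by (simp add: abs_mult)
  qed
  also have "\<dots> = fact n * B ^ n"
    by (simp add: card_permutations[of _ n])
  also have "\<dots> \<le> real n ^ n * B ^ n"
  proof (cases n)
    \<comment> \<open>\<open>B\<close> is nonnegative because some entry exists. For n = 0 it may be
      negative, but then both sides are 1.\<close>
    case (Suc n')
    then have "0 \<le> B"
      using assms[of 0 0] by simp
    then show ?thesis
      using fact_le_power[where 'a = real and n = n] by (intro mult_right_mono) simp_all
  qed simp
  finally show ?thesis
    by (simp add: power_mult_distrib)
qed

section \<open>Integer combinations of the basis and one further vector\<close>

definition gen :: "nat \<Rightarrow> (nat \<Rightarrow> nat \<Rightarrow> real) \<Rightarrow> (nat \<Rightarrow> real) \<Rightarrow> (nat \<Rightarrow> real) \<Rightarrow> bool" where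
  "gen n U X w \<longleftrightarrow> (\<exists>(z :: nat \<Rightarrow> int) (z0 :: int). \<forall>i<n. w i = (\<Sum>k<n. U k i * z k) + X i * z0)"

lemma gen_self: "gen n U X X"
  unfolding gen_def by (rule exI[of _ "\<lambda>_. 0"], rule exI[of _ 1]) simp

text \<open>A vector reduced to zero contributes nothing, so its place is free for the next
  generator.\<close>

lemma gen_vanish:
  assumes "gen n U X w" "\<And>i. i < n \<Longrightarrow> X i = 0"
  shows "gen n U Y w"
proof -
  obtain z z0 where "\<And>i. i < n \<Longrightarrow> w i = (\<Sum>k<n. U k i * of_int (z k)) + X i * of_int z0"
    using assms(1) unfolding gen_def by blast
  then show ?thesis
    unfolding gen_def using assms(2) by (intro exI[of _ z] exI[of _ 0]) simp
qed

text \<open>The subtracted multiples \<open>q\<close> are paid back, with factor \<open>z0\<close>,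
  in the coefficients of U.\<close>

lemma gen_reduce:
  assumes "gen n U X w"
  shows "gen n U (\<lambda>i. X i - (\<Sum>k<n. U k i * of_int (q k))) w"
proof -
  obtain z z0 where "\<And>i. i < n \<Longrightarrow> w i = (\<Sum>k<n. U k i * of_int (z k)) + X i * of_int z0"
    using assms unfolding gen_def by blast
  then have "w i = (\<Sum>k<n. U k i * of_int (z k + z0 * q k)) + (X i - (\<Sum>k<n. U k i * of_int (q k))) * of_int z0"
    if "i < n" for i
    using that by (simp add: algebra_simps sum.distrib sum_distrib_left)
  then show ?thesis
    unfolding gen_def by (intro exI[of _ "\<lambda>k. z k + z0 * q k"] exI[of _ z0]) blast
qed

text \<open>The n + 1 generating vectors stay the same; two of them trade places, and so do their
  coefficients.\<close>

lemma gen_exchange: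
  assumes "gen n U X w" "p < n"
  shows "gen n (U(p := X)) (U p) w"
proof -
  obtain z z0 where *: "\<And>i. i < n \<Longrightarrow> w i = (\<Sum>k<n. U k i * of_int (z k)) + X i * of_int z0"
    using assms unfolding gen_def by blast
  have "w i = (\<Sum>k<n. (U(p := X)) k i * of_int ((z(p := z0)) k)) + U p i * of_int (z p)" if "i < n" for i
    using that assms(2) *[OF that] by (simp add: sum.remove[of "{..<n}" p])
  then show ?thesis
    unfolding gen_def by (intro exI[of _ "z(p := z0)"] exI[of _ "z p"]) blast
qed

lemma abs_diff_nearest: "\<bar>x - nearest x\<bar> \<le> 1 / 2"
  unfolding nearest_def by linarith

section \<open>The program and its running time\<close>

definition "Find = Seq (Const 12 0) (For 11 1 (block [Copy_Input 11, Const 22 0, Const 24 0, Dot 10,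
  Arith 24 Mul 24 24, If_Less 22 24 (Copy 12 11) Skip]))"

lemma wp_Find:
  assumes "sizes s n r" "rep s n inp U W X c m" "r 10 = real i"
    and nz: "\<exists>j<s. mult_vec n W (\<lambda>i. inp (j * n + i)) i \<noteq> 0"
  shows "wp Find r m (\<lambda>t r' m'. t \<le> s * (n * 39 + 12) + 3 \<and> agree 11 r r' \<and> (\<exists>X. rep s n inp U W X c m') \<and>
    (\<exists>J<s. r' 12 = real J \<and> mult_vec n W (\<lambda>i. inp (J * n + i)) i \<noteq> 0))"
proof -
  let ?d = "\<lambda>j. mult_vec n W (\<lambda>i. inp (j * n + i)) i"
  have "wp (For 11 1 (block [Copy_Input 11, Const 22 0, Const 24 0, Dot 10,
      Arith 24 Mul 24 24, If_Less 22 24 (Copy 12 11) Skip])) (r(12 := 0)) m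
    (\<lambda>t r' m'. t \<le> s * (n * 39 + 12) + 2 \<and> agree 11 r r' \<and> (\<exists>X. rep s n inp U W X c m') \<and>
    (\<exists>J<s. r' 12 = real J \<and> ?d J \<noteq> 0))"
  \<comment> \<open>Until the first success register 12 holds just some natural number, initially 0;
    the implication claims more only once a suitable generator has been passed.\<close>
  proof (rule wp_For_bound[where c = "n * 39 + 9" and N = s and I = "\<lambda>j r' m'. agree 11 r r' \<and>
      (\<exists>X. rep s n inp U W X c m') \<and> (\<exists>J. r' 12 = real J \<and> ((\<exists>j'<j. ?d j' \<noteq> 0) \<longrightarrow> J < s \<and> ?d J \<noteq> 0))"])
    fix j r' m'
    assume j: "j < s" "agree 11 r r' \<and> (\<exists>X. rep s n inp U W X c m') \<and>
      (\<exists>J. r' 12 = real J \<and> ((\<exists>j'<j. ?d j' \<noteq> 0) \<longrightarrow> J < s \<and> ?d J \<noteq> 0))" "r' 11 = real j" "r' 1 = real s"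
    obtain X' J where X': "rep s n inp U W X' c m'"
      and J: "r' 12 = real J" "(\<exists>j'<j. ?d j' \<noteq> 0) \<longrightarrow> J < s \<and> ?d J \<noteq> 0"
      using j(2) by blast
    have r': "sizes s n r'" "r' 10 = real i"
      using j assms agree_sizes[of s n r 11 r'] by (auto simp: agree_def)
    show "wp (block [Copy_Input 11, Const 22 0, Const 24 0, Dot 10,
      Arith 24 Mul 24 24, If_Less 22 24 (Copy 12 11) Skip]) r' m' (\<lambda>t r' m'. t \<le> n * 39 + 9 \<and>
      r' 11 = real j \<and> r' 1 = real s \<and> agree 11 r (r'(31 := 1, 11 := real (Suc j))) \<and>
      (\<exists>X. rep s n inp U W X c m') \<and> (\<exists>J. (r'(31 := 1, 11 := real (Suc j))) 12 = real J \<and>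
         ((\<exists>j'<Suc j. ?d j' \<noteq> 0) \<longrightarrow> J < s \<and> ?d J \<noteq> 0)))"
      apply simp
      apply (rule wp_mono[OF wp_Copy_Input[OF r'(1) X' j(3,1)]], simp)
      apply simp
      apply (elim conjE)
      subgoal premises prems for t r2 m2
      proof -
        note r2 = agree_sizes[OF r'(1) prems(2)]
        have "sizes s n (r2(22 := 0, 24 := 0))" "r2 10 = real i"
          using prems(2) r' r2 by (auto simp: agree_def sizes_def)
        then have "wp (Dot 10) (r2(22 := 0, 24 := 0)) m2 (\<lambda>t r' m'. t \<le> n * 23 + 2 \<and>
          agree 24 (r2(22 := 0, 24 := 0)) r' \<and> r' 24 = ?d j \<and> m' = m2)"
          by (intro wp_Dot[OF _ prems(3)]) auto
        then show ?thesis
          apply (rule wp_mono)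
          apply (elim conjE)
          subgoal premises prems2 for t3 r3 m3
          proof -
            have [simp]: "r3 24 = ?d j" "r3 22 = 0" "m3 = m2" "r3 11 = real j" "r3 1 = real s"
              "r3 (Suc 0) = real s" "r3 12 = real J" "agree 11 r r3"
              using prems2 prems j(2,3) j(4) J by (auto simp: agree_def)
            have [simp]: "0 < ?d j * ?d j \<longleftrightarrow> ?d j \<noteq> 0"
              by (simp add: zero_less_mult_iff) linarith
            show ?thesis
              using prems(1) prems2(1) J(2) j(1) exI[of "\<lambda>X. rep s n inp U W X c m2", OF prems(3)]
                  by (auto simp: less_Suc_eq)
          qed
          done
      qed
      done
  qed (use assms in \<open>auto simp: sizes_def algebra_simps intro: exI[of _ 0]\<close>)
  then show ?thesis
    by (auto simp: Find_def elim!: wp_mono)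
qed

text \<open>\<open>Find\<close> runs through all generators, so the chosen one may have been
  overwritten and is copied once more.\<close>

definition "Select = block [Find, Copy_Input 12, Matvec, Exchange 10]"

lemma wp_Select:
  assumes "sizes s n r" "rep s n inp U W X c m" "r 10 = real i" "i < n"
    and nz: "\<exists>j<s. mult_vec n W (\<lambda>i. inp (j * n + i)) i \<noteq> 0"
  shows "wp Select r m (\<lambda>t r' m'. t \<le> s * (n * 39 + 12) + n * (n * 55 + 102) + 9 \<and> agree 11 r r' \<and>
    (\<exists>J<s. let X = (\<lambda>i. inp (J * n + i)) in mult_vec n W X i \<noteq> 0 \<and>
      (\<exists>X' c'. rep s n inp (U(i := X)) (pivot n i (mult_vec n W X) W) X' c' m')))"
  unfolding Select_def Let_def
  apply simp
  apply (rule wp_mono[OF wp_Find[OF assms(1,2,3) nz]])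
  apply (elim conjE exE)
  subgoal premises prems1 for t1 r1 m1 X1 J
  proof -
    note r1 = agree_sizes[OF assms(1) prems1(2), simplified]
    let ?X = "\<lambda>i. inp (J * n + i)"
    show ?thesis
      apply (rule wp_mono[OF wp_Copy_Input[OF r1 prems1(3,5,4)]], simp, simp)
      apply (elim conjE)
      subgoal premises prems2 for t2 r2 m2
      proof -
        note r2 = agree_sizes[OF r1 prems2(2), simplified]
        show ?thesis
          apply (rule wp_mono[OF wp_Matvec[OF r2 prems2(3)]], simp)
          apply (elim conjE)
          subgoal premises prems3 for t3 r3 m3
          proof -
            note r3 = agree_sizes[OF r2 prems3(2), simplified]
            have a: "agree 11 r r3"
              using prems1(2) prems2(2) prems3(2) by (auto simp: agree_def)
            then have "r3 10 = real i"
              using assms(3) by (simp add: agree_def)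
            then show ?thesis
              apply (intro wp_mono[OF wp_Exchange[OF r3 prems3(3) _ assms(4)]])
                apply (use prems1(6) in simp_all)
              using prems1 prems2 prems3 a
              by (auto simp: agree_def algebra_simps intro!: exI[of _ J])
          qed
          done
      qed
      done
  qed
  done

definition "Init = For 10 0 (block [Const 23 1, Put 0 10 10 23, Put 1 10 10 23])"

lemma wp_Init:
  assumes "sizes s n r" "rep s n inp (\<lambda>_ _. 0) (\<lambda>_ _. 0) X c m"
  shows "wp Init r m (\<lambda>t r' m'. t \<le> n * 22 + 2 \<and> agree 10 r r' \<and>
    (\<exists>U W. rep s n inp U W X c m' \<and> dual n U W))"
  unfolding Init_def
proof (rule wp_For_bound[where c = 19 and N = n and I = "\<lambda>l r' m'. agree 10 r r' \<and>
    rep s n inp (\<lambda>k i. if k = i \<and> i < l then 1 else 0) (\<lambda>k i. if k = i \<and> i < l then 1 else 0) X c m'"])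
  fix l r' m'
  let ?U = "\<lambda>l k i. if k = i \<and> i < l then 1 else 0 :: real"
  assume l: "l < n" "agree 10 r r' \<and> rep s n inp (?U l) (?U l) X c m'" "r' 10 = real l" "r' 0 = real n"
  have "sizes s n r'"
    using l assms agree_sizes[of s n r 10 r'] by auto
  note [simp] = sizesD[OF this]
  have "rep s n inp (?U (Suc l)) (?U (Suc l)) X c (m'(loc s n 0 l l := 1, loc s n (Suc 0) l l := 1))"
    by (rule rep_cong[OF rep_update(2)[OF rep_update(1)[OF conjunct2[OF l(2)]]]])
      (use l in auto)
  then show "wp (block [Const 23 1, Put 0 10 10 23, Put 1 10 10 23]) r' m' (\<lambda>t r' m'. t \<le> 19 \<and>
    r' 10 = real l \<and> r' 0 = real n \<and> agree 10 r (r'(31 := 1, 10 := real (Suc l))) \<and>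
    rep s n inp (?U (Suc l)) (?U (Suc l)) X c m')"
    using l by simp
next
  fix T r' m'
  let ?U = "\<lambda>k i. if k = i \<and> i < n then 1 else 0 :: real"
  assume *: "agree 10 r r' \<and> rep s n inp ?U ?U X c m'" "T \<le> n * (19 + 3) + 2"
  have "mult_vec n ?U (?U l) k = (if k = l then 1 else 0)" if "k < n" "l < n" for k l
  proof -
    have "mult_vec n ?U (?U l) k = (\<Sum>i<n. if i = k then (if k = l then 1 else 0) else 0)"
      unfolding mult_vec_def by (rule sum.cong) auto
    then show ?thesis
      using that by simp
  qed
  then have "dual n ?U ?U"
    by (simp add: dual_def)
  then show "T \<le> n * 22 + 2 \<and> agree 10 r r' \<and> (\<exists>U W. rep s n inp U W X c m' \<and> dual n U W)"
    using * by auto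
qed (use assms in \<open>auto simp: sizes_def\<close>)

lemma pivot_cong:
  assumes "\<And>k. k < n \<Longrightarrow> c k = c' k" "p < n"
  shows "pivot n p c W = pivot n p c' W"
  using assms by (intro ext) (simp add: pivot_def)

text \<open>By duality the coordinates of the subtracted combination are its coefficients
  \<open>q\<close>, which justifies the in-place update in \<open>Reduce\<close>.\<close>

lemma mult_vec_reduce:
  assumes "dual n U W" "l < n"
  shows "mult_vec n W (\<lambda>i. X i - (\<Sum>k<n. U k i * q k)) l = mult_vec n W X l - q l"
proof -
  have "(\<Sum>i<n. W l i * (\<Sum>k<n. U k i * q k)) = (\<Sum>k<n. q k * mult_vec n W (U k) l)"
    unfolding mult_vec_def sum_distrib_left by (subst sum.swap) (simp add: ac_simps)
  also have "\<dots> = (\<Sum>k<n. if k = l then q k else 0)"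
    using assms by (intro sum.cong) (auto simp: dual_def)
  also have "\<dots> = q l"
    using assms(2) by simp
  finally show ?thesis
    by (simp add: mult_vec_def right_diff_distrib sum_subtractf)
qed

section \<open>The complete program\<close>

definition "Collect_Basis = For 10 0 Select"

text \<open>Register 11 is the stop flag, compared with the 1 in register 12. Comparing register 13
  with the dimension in register 0 asks whether the reduction left a nonzero coordinate; if so, the
  old basis vector becomes the current one.\<close>

definition "Insert_Loop = While_Less 11 12 (block [Matvec, Reduce, If_Less 13 0 (Exchange 13) (Const 11 1)])"

definition "Insert_All = For 10 1 (block [Copy_Input 10, Const 11 0, Const 12 1, Insert_Loop])"

definition "Write_Output = For 10 0 (For 11 0 (block
  [Fetch 23 0 10 11, Arith 24 Mul 10 0, Arith 24 Add 24 11, Store 24 23]))"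

definition "Basis_Program = block [Init, Collect_Basis, Insert_All, Write_Output]"

text \<open>The output overwrites the input area at addresses below n^2. As n^2 \<le> s n, it ends
  before the arrays begin, and U stays readable during the copying.\<close>

lemma wp_Write_Output:
  assumes "sizes s n r" "rep s n inp U W X c m" "n \<le> s"
  shows "wp Write_Output r m (\<lambda>t r' m'. t \<le> n * (n * 15 + 5) + 2 \<and> (\<forall>k<n. \<forall>i<n. m' (k * n + i) = U k i))"
proof -
  define J where "J k l m' \<longleftrightarrow> (\<forall>k. \<forall>i<n. m' (loc s n 0 k i) = U k i) \<and>
    (\<forall>k' i'. i' < n \<and> (k' < k \<or> k' = k \<and> i' < l) \<longrightarrow> m' (k' * n + i') = U k' i')" for k l and m' :: "nat \<Rightarrow> real"
  show ?thesis
    unfolding Write_Output_def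
  proof (rule wp_For_bound[where c = "n * 15 + 2" and N = n and I = "\<lambda>k r' m'. agree 10 r r' \<and> J k 0 m'"])
    fix k r' m'
    assume k: "k < n" "agree 10 r r' \<and> J k 0 m'" "r' 10 = real k" "r' 0 = real n"
    show "wp (For 11 0 (block [Fetch 23 0 10 11, Arith 24 Mul 10 0, Arith 24 Add 24 11, Store 24 23])) r' m'
      (\<lambda>t r' m'. t \<le> n * 15 + 2 \<and> r' 10 = real k \<and> r' 0 = real n \<and>
        agree 10 r (r'(31 := 1, 10 := real (Suc k))) \<and> J (Suc k) 0 m')"
    proof (rule wp_For_bound[where c = 12 and N = n and I = "\<lambda>l r'' m''. agree 11 r' r'' \<and> J k l m''"])
      fix l r'' m''
      assume l: "l < n" "agree 11 r' r'' \<and> J k l m''" "r'' 11 = real l" "r'' 0 = real n"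
      have r'': "sizes s n r''" "r'' 10 = real k"
        using assms(1) k l by (auto simp: agree_def sizes_def)
      have lt: "k * n + l < s * n"
        using less_mult_add k(1) l(1) assms(3) by auto
      have *: "m'' (loc s n 0 k l) = U k l"
        using l by (simp add: J_def)
      have "J k (Suc l) (m''(k * n + l := U k l))"
        using l(1,2) lt by (auto simp: J_def less_Suc_eq)
      then show "wp (block [Fetch 23 0 10 11, Arith 24 Mul 10 0, Arith 24 Add 24 11, Store 24 23]) r'' m''
        (\<lambda>t r'' m''. t \<le> 12 \<and> r'' 11 = real l \<and> r'' 0 = real n \<and>
          agree 11 r' (r''(31 := 1, 11 := real (Suc l))) \<and> J k (Suc l) m'')"
        using l(2-4) sizesD[OF r''(1)] r''(2) * by (simp add: wp_Store[where a = "k * n + l"])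
    next
      fix T r'' m''
      assume "agree 11 r' r'' \<and> J k n m''" "T \<le> n * (12 + 3) + 2"
      then show "T \<le> n * 15 + 2 \<and> r'' 10 = real k \<and> r'' 0 = real n \<and>
        agree 10 r (r''(31 := 1, 10 := real (Suc k))) \<and> J (Suc k) 0 m''"
        using k by (auto simp: agree_def J_def less_Suc_eq)
    qed (use k in auto)
  qed (use assms rep_access(2)[OF assms(2)] in \<open>auto simp: sizes_def algebra_simps J_def\<close>)
qed

section \<open>Total number of operations\<close>

lemma total_time_aux:
  fixes a b p q u w n s e t1 t2 t3 t4 :: nat
  assumes "p \<le> a" "q \<le> b" "u \<le> p" "w \<le> a" "s \<le> p" "e \<le> q" "n \<le> u" "1 \<le> n" "t1 \<le> n * 22 + 2"
    "t2 \<le> 39 * a + 12 * p + 55 * w + 102 * u + 12 * n + 2"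
    "t3 \<le> 87 * a + 135 * p + 17 * s + 87 * b + 119 * q + 9 * e + 2" "t4 \<le> 15 * u + 5 * n + 2"
  shows "t1 + (t2 + (t3 + t4)) \<le> 1000 * (a + b)"
proof -
  have a: "u \<le> a" "n \<le> a" "s \<le> a" "e \<le> b" "1 \<le> a"
    using assms(1-8) by linarith+
  have "t1 \<le> 24 * a"
    using assms(9) a by linarith
  moreover have "t2 \<le> 222 * a"
    using assms(1,4,10) a by linarith
  moreover have "t3 \<le> 241 * a + 215 * b"
    using assms(1,2,11) a by linarith
  moreover have "t4 \<le> 22 * a"
    using assms(12) a by linarith
  ultimately show ?thesis
    unfolding distrib_left by linarith
qed

text \<open>With n \<le> s the cubic setup cost is absorbed by s n^2. The monomials become the
  variables of \<open>total_time_aux\<close>, where linear arithmetic suffices; there the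
  coefficients of \<open>a\<close> and \<open>b\<close> add up to 509 and 215, and 1000 is a round
  number above both.\<close>

lemma total_time:
  fixes n s e t1 t2 t3 t4 :: nat
  assumes "1 \<le> n" "n \<le> s" "t1 \<le> n * 22 + 2" "t2 \<le> n * (s * (n * 39 + 12) + n * (n * 55 + 102) + 12) + 2"
    "t3 \<le> s * (n * 16 + 8 + (n * (n * 87 + 119) + 9)) + e * (n * (n * 87 + 119) + 9) + 2"
    "t4 \<le> n * (n * 15 + 5) + 2"
  shows "t1 + (t2 + (t3 + t4)) \<le> 1000 * (s * n^2 + n^2 * e)"
proof -
  have "n * s \<le> s * n\<^sup>2" "e * n \<le> n\<^sup>2 * e" "n * n \<le> n * s" "n * n * n \<le> s * n\<^sup>2" "s \<le> n * s" "e \<le> e * n"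
    "n \<le> n * n"
    using assms(1,2) by (simp_all add: power2_eq_square)
  moreover have "n * (s * (n * 39 + 12) + n * (n * 55 + 102) + 12) + 2 =
      39 * (s * n\<^sup>2) + 12 * (n * s) + 55 * (n * n * n) + 102 * (n * n) + 12 * n + 2"
    "s * (n * 16 + 8 + (n * (n * 87 + 119) + 9)) + e * (n * (n * 87 + 119) + 9) + 2 =
      87 * (s * n\<^sup>2) + 135 * (n * s) + 17 * s + 87 * (n\<^sup>2 * e) + 119 * (e * n) + 9 * e + 2"
    "n * (n * 15 + 5) + 2 = 15 * (n * n) + 5 * n + 2"
    by (simp_all add: algebra_simps power2_eq_square)
  ultimately show ?thesis
    using assms by (intro total_time_aux[of "n * s" "s * n\<^sup>2" "e * n" "n\<^sup>2 * e" "n * n" "n * n * n" s e n])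
        presburger+
qed

text \<open>Membership in the lattice is an abstract predicate on coordinate functions, the form in
  which the memory holds vectors. \<open>full\<close> is the shape in which full rank is used: no
  dual vector is orthogonal to every generator.\<close>

locale generators =
  fixes n s :: nat and inp :: "nat \<Rightarrow> real" and lat :: "(nat \<Rightarrow> real) \<Rightarrow> bool"
  assumes lat_int: "lat f \<Longrightarrow> lat g \<Longrightarrow> (\<Sum>i<n. f i * g i) \<in> \<int>"
    and lat_diff: "lat f \<Longrightarrow> lat g \<Longrightarrow> lat (\<lambda>i. f i - g i * of_int z)"
    and lat_gen: "j < s \<Longrightarrow> lat (\<lambda>i. inp (j * n + i))"
    and full: "dual n U W \<Longrightarrow> k < n \<Longrightarrow> \<exists>j<s. mult_vec n W (\<lambda>i. inp (j * n + i)) k \<noteq> 0"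
begin

abbreviation vct :: "nat \<Rightarrow> nat \<Rightarrow> real" where
  "vct j \<equiv> \<lambda>i. inp (j * n + i)"

text \<open>Full rank provides a generator whose coordinate of index l is nonzero, and it replaces
  \<open>U l\<close>; later exchanges take place at other indices and keep it.\<close>

lemma wp_Collect_Basis:
  assumes "sizes s n r" "rep s n inp U W X c m" "dual n U W"
  shows "wp Collect_Basis r m (\<lambda>t r' m'. t \<le> n * (s * (n * 39 + 12) + n * (n * 55 + 102) + 12) + 2 \<and>
    agree 10 r r' \<and> (\<exists>U W X c. rep s n inp U W X c m' \<and> dual n U W \<and> (\<forall>k<n. \<exists>j<s. U k = vct j)))"
  unfolding Collect_Basis_def
proof (rule wp_For_bound[where c = "s * (n * 39 + 12) + n * (n * 55 + 102) + 9" and N = n and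
    I = "\<lambda>l r' m'. agree 10 r r' \<and>
     (\<exists>U W X c. rep s n inp U W X c m' \<and> dual n U W \<and> (\<forall>k<l. \<exists>j<s. U k = vct j))"])
  fix l r' m'
  assume l: "l < n" "agree 10 r r' \<and>
    (\<exists>U W X c. rep s n inp U W X c m' \<and> dual n U W \<and> (\<forall>k<l. \<exists>j<s. U k = vct j))"
    "r' 10 = real l" "r' 0 = real n"
  obtain U W X c where U: "rep s n inp U W X c m'" "dual n U W" "\<forall>k<l. \<exists>j<s. U k = vct j"
    using l(2) by blast
  have r': "sizes s n r'"
    using l assms agree_sizes[of s n r 10 r'] by auto
  show "wp Select r' m' (\<lambda>t r' m'. t \<le> s * (n * 39 + 12) + n * (n * 55 + 102) + 9 \<and>
    r' 10 = real l \<and> r' 0 = real n \<and> agree 10 r (r'(31 := 1, 10 := real (Suc l))) \<and>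
    (\<exists>U W X c. rep s n inp U W X c m' \<and> dual n U W \<and> (\<forall>k<Suc l. \<exists>j<s. U k = vct j)))"
    apply (rule wp_mono[OF wp_Select[OF r' U(1) l(3,1) full[OF U(2) l(1)]]])
    apply (unfold Let_def)
    apply (elim conjE exE)
    subgoal for t r2 m2 J X' c'
      using l(2-4) U(3) dual_pivot[OF U(2) l(1), of "vct J"]
      by (intro conjI exI[of _ "U(l := vct J)"] exI[of _ "pivot n l (mult_vec n W (vct J)) W"] exI[of _ X']
          exI[of _ c'])
        (auto simp: agree_def less_Suc_eq)
    done
qed (use assms in \<open>auto simp: sizes_def algebra_simps\<close>)

section \<open>Insertion of the generators with the determinant as potential\<close>

lemma lat_sum:
  fixes q :: "nat \<Rightarrow> int" and l :: nat
  assumes "lat X" "\<forall>k<l. lat (U k)"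
  shows "lat (\<lambda>i. X i - (\<Sum>k<l. U k i * of_int (q k)))"
  using assms(2)
proof (induction l)
  case (Suc l)
  then show ?case
    using lat_diff[of "\<lambda>i. X i - (\<Sum>k<l. U k i * of_int (q k))" "U l" "q l"] by (simp add: diff_diff_eq)
qed (use assms(1) in simp)

text \<open>The number \<open>e\<close> counts the exchanges made so far; the determinant is the potential that bounds it.\<close>

definition lat_basis :: "(nat \<Rightarrow> nat \<Rightarrow> real) \<Rightarrow> (nat \<Rightarrow> nat \<Rightarrow> real) \<Rightarrow> real \<Rightarrow> nat \<Rightarrow> bool" where
  "lat_basis U W D e \<longleftrightarrow> dual n U W \<and> (\<forall>k<n. lat (U k)) \<and> 2 ^ e * \<bar>det (col_mat n U)\<bar> \<le> D"

lemma lat_basis_bound: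
  assumes "lat_basis U W D e"
  shows "2 ^ e \<le> D"
proof -
  have "1 \<le> \<bar>det (col_mat n U)\<bar>"
    using assms by (intro abs_det_ge_1[of n U W]) (auto simp: lat_basis_def lat_int)
  then have "2 ^ e * 1 \<le> 2 ^ e * \<bar>det (col_mat n U)\<bar>"
    by (intro mult_left_mono) simp_all
  then show ?thesis
    using assms unfolding lat_basis_def by linarith
qed

text \<open>The determinant is multiplied by the reduced coordinate of index p. This factor is
  nonzero, so duality survives, and at most 1/2 in absolute value, which pays for the
  exchange.\<close>

lemma lat_basis_exchange:
  fixes W X
  defines "c \<equiv> mult_vec n W X"
  assumes "lat_basis U W D e" "lat X" "p < n" "c p \<noteq> nearest (c p)"
  shows "lat_basis (U(p := \<lambda>i. X i - (\<Sum>k<n. U k i * nearest (c k)))) (pivot n p (\<lambda>k.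
      c k - nearest (c k)) W) D (Suc e)"
proof -
  let ?X = "\<lambda>i. X i - (\<Sum>k<n. U k i * nearest (c k))"
  have U: "dual n U W" "\<And>k. k < n \<Longrightarrow> lat (U k)" "2 ^ e * \<bar>det (col_mat n U)\<bar> \<le> D"
    using assms(2) by (auto simp: lat_basis_def)
  have X: "mult_vec n W ?X k = c k - nearest (c k)" if "k < n" for k
    using mult_vec_reduce[OF U(1) that] by (simp add: c_def)
  then have "pivot n p (\<lambda>k. c k - nearest (c k)) W = pivot n p (mult_vec n W ?X) W"
    using assms(4) by (intro pivot_cong) auto
  moreover have "dual n (U(p := ?X)) (pivot n p (mult_vec n W ?X) W)"
    using X[OF assms(4)] assms(5) by (intro dual_pivot[OF U(1) assms(4)]) simp
  moreover have "\<bar>det (col_mat n (U(p := ?X)))\<bar> \<le> 1 / 2 * \<bar>det (col_mat n U)\<bar>"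
    unfolding det_exchange[OF U(1) assms(4)] X[OF assms(4)] abs_mult
    by (intro mult_right_mono abs_diff_nearest) simp
  then have "2 ^ e * (2 * \<bar>det (col_mat n (U(p := ?X)))\<bar>) \<le> 2 ^ e * \<bar>det (col_mat n U)\<bar>"
    by (intro mult_left_mono) simp_all
  then have "2 ^ Suc e * \<bar>det (col_mat n (U(p := ?X)))\<bar> \<le> D"
    using U(3) by (simp only: power_Suc mult.assoc mult.left_commute[of "2 ^ e"])
  ultimately show ?thesis
    using U lat_sum[OF assms(3), of n U "\<lambda>k. nearest (c k)"] by (simp add: lat_basis_def del: power_Suc)
qed

lemma reduced_vanish:
  fixes W X
  defines "c \<equiv> mult_vec n W X"
  assumes "dual n U W" "\<forall>k<n. c k = nearest (c k)" "i < n"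
  shows "X i - (\<Sum>k<n. U k i * nearest (c k)) = 0"
  using dual_expand[OF assms(2,4), of X] assms(3) by (simp add: c_def)

text \<open>Every round but the last makes an exchange, whence \<open>Suc e' - e\<close> rounds. The
  set \<open>S\<close> collects the vectors that must remain integer combinations.\<close>

lemma wp_Insert_Loop:
  assumes "sizes s n r" "rep s n inp U W X c m" "lat_basis U W D e" "lat X" "r 11 = 0" "r 12 = 1"
    "\<forall>w\<in>S. gen n U X w"
  shows "wp Insert_Loop r m (\<lambda>t r' m'. agree 11 r r' \<and> (\<exists>U W X c e'. e \<le> e' \<and>
    t \<le> (Suc e' - e) * (n * (n * 87 + 119) + 9) + 1 \<and>
    rep s n inp U W X c m' \<and> lat_basis U W D e' \<and> (\<forall>w\<in>S. gen n U (\<lambda>_. 0) w)))"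
proof -
  \<comment> \<open>Cost of one round: the bounds of \<open>Matvec\<close>, \<open>Reduce\<close>
    and \<open>Exchange\<close> add up to n (87 n + 119) + 7, and two tests are added.\<close>
  let ?K = "n * (n * 87 + 119) + 9"
  \<comment> \<open>No basis that is reached can have exchange count \<open>E\<close> or more, so
    \<open>E - e\<close> strictly decreases and the loop halts.\<close>
  obtain E where E: "D < 2 ^ E"
    using real_arch_pow[of 2 D] by auto
  have e_less: "e < E" if "lat_basis U W D e" for U W e
    using lat_basis_bound[OF that] E power_strict_increasing_iff[of "2 :: real" e E] by linarith
  show ?thesis
    using assms
  proof (induction "E - e" arbitrary: e U W X c r m rule: less_induct)
    case less
    note U = less.prems(3)[unfolded lat_basis_def]
    let ?c = "mult_vec n W X"
    let ?X = "\<lambda>i. X i - (\<Sum>k<n. U k i * nearest (?c k))"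
    have gen': "\<forall>w\<in>S. gen n U ?X w"
      using less.prems(7) gen_reduce by auto
    show ?case
      unfolding Insert_Loop_def
      apply (rule wp_While_True)
      using less.prems(5,6) apply simp
      unfolding Insert_Loop_def[symmetric]
      apply simp
      apply (rule wp_mono[OF wp_Matvec[OF less.prems(1,2)]])
      apply (elim conjE)
      subgoal premises prems1 for t1 r1 m1
      proof -
        note r1 = agree_sizes[OF less.prems(1) prems1(2), simplified]
        show ?thesis
          apply (rule wp_mono[OF wp_Reduce[OF r1 prems1(3)]])
          apply (elim conjE exE)
          subgoal premises prems2 for t2 r2 m2 p
          proof -
            note r2 = agree_sizes[OF r1 prems2(2), simplified]
            have ag: "agree 13 r r2"
              using prems1(2) prems2(2) by (auto simp: agree_def)
            show ?thesis
            proof (cases "p < n")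
              case True
              then have nz: "?c p \<noteq> nearest (?c p)"
                using prems2(5) by auto
              note U' = lat_basis_exchange[OF less.prems(3,4) True nz]
              have "wp (Exchange 13) r2 m2 (\<lambda>t r' m'. t \<le> n * (n * 32 + 70) + 2 \<and> agree 20 r2 r' \<and>
                  rep s n inp (U(p := ?X)) (pivot n p (\<lambda>k. ?c k - nearest (?c k)) W) (U p) (\<lambda>k.
                      ?c k - nearest (?c k)) m')"
                using nz by (intro wp_Exchange[OF r2 prems2(3,4) True]) auto
              then show ?thesis
                using True prems2(4) sizesD[OF r2] apply simp
                apply (elim wp_mono conjE)
                subgoal premises prems3 for t3 r3 m3
                proof -
                  have r3: "sizes s n r3" "agree 11 r r3" "r3 11 = 0" "r3 12 = 1"
                    using agree_sizes[OF r2 prems3(6)] ag prems3(6) less.prems(5,6) by (auto simp: agree_def)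
                  have "wp Insert_Loop r3 m3 (\<lambda>t r' m'. agree 11 r3 r' \<and> (\<exists>U W X c e'. Suc e \<le> e' \<and>
                    t \<le> (Suc e' - Suc e) * ?K + 1 \<and>
                    rep s n inp U W X c m' \<and> lat_basis U W D e' \<and> (\<forall>w\<in>S. gen n U (\<lambda>_. 0) w)))"
                    using e_less[OF less.prems(3)] U True gen' gen_exchange[OF _ True]
                    by (intro less.hyps[OF _ r3(1) prems3(7) U' _ r3(3,4)]) auto
                  then show ?thesis
                    apply (elim wp_mono conjE exE)
                    subgoal premises prems4 for t4 r4 m4 U4 W4 X4 c4 e4
                    proof -
                      \<comment> \<open>The difference \<open>d\<close> replaces truncated
                        subtraction by addition.\<close>
                      obtain d where d: "e4 = Suc e + d"
                        using prems4(2) le_Suc_ex by blast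
                      have "Suc (t1 + (t2 + Suc t3) + t4) \<le> (Suc e4 - e) * ?K + 1"
                        using prems1(1) prems2(1) prems3(5) prems4(3) unfolding d by (simp add: algebra_simps)
                      moreover have "e \<le> e4" "agree 11 r r4"
                        using prems4(2) agree_trans[OF r3(2) prems4(1)] by auto
                      ultimately show ?thesis
                        using prems4(4-6) by (simp, blast)
                    qed
                    done
                qed
                done
            next
              case False
              then have "p = n" "\<forall>k<n. ?c k = nearest (?c k)"
                using prems2(5) by auto
              then have X0: "\<And>i. i < n \<Longrightarrow> ?X i = 0"
                using reduced_vanish U by blast
              have "wp Insert_Loop (r2(11 := 1)) m2 (\<lambda>t r' m'. t = 1 \<and> r' = r2(11 := 1) \<and> m' = m2)"
                unfolding Insert_Loop_def using ag less.prems(6) by (intro wp_While_False)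
                    (auto simp: agree_def)
              then show ?thesis
                using False prems2(4) sizesD[OF r2] apply simp
                apply (elim wp_mono conjE)
                subgoal premises prems3 for t3 r3 m3
                proof -
                  have "Suc (t1 + (t2 + 2) + t3) \<le> (Suc e - e) * ?K + 1"
                    using prems1(1) prems2(1) prems3 by (simp add: algebra_simps)
                  moreover have "\<forall>w\<in>S. gen n U (\<lambda>_. 0) w"
                    using gen' gen_vanish X0 by blast
                  ultimately show ?thesis
                    using prems2(3) prems3 ag less.prems(3)
                    apply (intro conjI)
                     apply (simp add: agree_def)
                    apply (rule exI[of _ U], rule exI[of _ W], rule exI[of _ ?X],
                        rule exI[of _ "\<lambda>k. ?c k - nearest (?c k)"], rule exI[of _ e])
                    apply simp
                    done
                qed
                done
            qed
          qed
          done
      qed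
      done
  qed
qed


text \<open>Amortisation: \<open>e\<close> counts the exchanges over all generators, and only the
  final round of each is charged per generator. The 8 consists of 2 from copying, two constants, the
  last test of \<open>Insert_Loop\<close> and 3 for the outer loop.\<close>

lemma wp_Insert_All:
  fixes K
  defines "K \<equiv> n * (n * 87 + 119) + 9"
  assumes "sizes s n r" "rep s n inp U W X c m" "lat_basis U W D 0"
  shows "wp Insert_All r m (\<lambda>t r' m'. agree 10 r r' \<and> (\<exists>U W X c e. t \<le> s * (n * 16 + 8 + K) + e * K + 2 \<and>
    rep s n inp U W X c m' \<and> lat_basis U W D e \<and> (\<forall>j<s. gen n U (\<lambda>_. 0) (vct j))))"
  unfolding Insert_All_def
proof (rule wp_For[where N = s and I = "\<lambda>j T r' m'. agree 10 r r' \<and> (\<exists>U W X c e.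
    T \<le> j * (n * 16 + 8 + K) + e * K + 1 \<and>
    rep s n inp U W X c m' \<and> lat_basis U W D e \<and> (\<forall>j'<j. gen n U (\<lambda>_. 0) (vct j')))"])
  fix j T r' m'
  assume j: "j < s" "agree 10 r r' \<and> (\<exists>U W X c e. T \<le> j * (n * 16 + 8 + K) + e * K + 1 \<and>
    rep s n inp U W X c m' \<and> lat_basis U W D e \<and> (\<forall>j'<j. gen n U (\<lambda>_. 0) (vct j')))"
    "r' 10 = real j" "r' 1 = real s"
  obtain U W X c e where U: "T \<le> j * (n * 16 + 8 + K) + e * K + 1" "rep s n inp U W X c m'"
    "lat_basis U W D e" "\<forall>j'<j. gen n U (\<lambda>_. 0) (vct j')"
    using j(2) by blast
  have r': "sizes s n r'"
    using j assms agree_sizes[of s n r 10 r'] by auto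
  \<comment> \<open>Earlier generators are already combinations of U alone, so the new one may take
    the additional place; it generates itself.\<close>
  have S: "\<forall>w\<in>vct ` {..j}. gen n U (vct j) w"
    using U(4) gen_vanish gen_self by (fastforce simp: le_less)
  show "wp (block [Copy_Input 10, Const 11 0, Const 12 1, Insert_Loop]) r' m' (\<lambda>t r' m'. r' 10 = real j \<and>
    r' 1 = real s \<and> agree 10 r (r'(31 := 1, 10 := real (Suc j))) \<and>
    (\<exists>U W X c e. T + t + 3 \<le> Suc j * (n * 16 + 8 + K) + e * K + 1 \<and>
      rep s n inp U W X c m' \<and> lat_basis U W D e \<and> (\<forall>j'<Suc j. gen n U (\<lambda>_. 0) (vct j'))))"
    apply simp
    apply (rule wp_mono[OF wp_Copy_Input[OF r' U(2) j(3,1)]], simp)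
    apply (elim conjE)
    subgoal premises prems1 for t1 r1 m1
    proof -
      have "sizes s n (r1(11 := 0, 12 := 1))"
        using agree_sizes[OF r' prems1(2)] by (simp add: sizes_def)
      note wp_Insert_Loop[OF this prems1(3) U(3) lat_gen[OF j(1)] _ _ S]
      then show ?thesis
        apply (rule wp_mono, simp, simp)
        apply (elim conjE exE)
        subgoal premises prems2 for t2 r2 m2 U2 W2 X2 c2 e2
        proof -
          obtain d where d: "e2 = e + d"
            using prems2(2) le_Suc_ex by blast
          have "T + (t1 + Suc (Suc t2)) + 3 \<le> Suc j * (n * 16 + 8 + K) + e2 * K + 1"
            using U(1) prems1(1) prems2(3) unfolding d K_def[symmetric] by (simp add: algebra_simps)
          moreover have "\<forall>j'<Suc j. gen n U2 (\<lambda>_. 0) (vct j')"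
            using prems2(6) by auto
          moreover have "r2 10 = real j" "r2 1 = real s" "agree 10 r (r2(31 := 1, 10 := real (Suc j)))"
            using prems2(1) prems1(2) j by (auto simp: agree_def)
          ultimately show ?thesis
            using prems2(4,5)
            apply (intro conjI)
               apply simp_all
            apply (rule exI[of _ U2], rule exI[of _ W2], rule exI[of _ X2], rule exI[of _ c2],
                rule exI[of _ e2])
            apply simp
            done
        qed
        done
    qed
    done
next
  show "agree 10 r (r(10 := 0)) \<and> (\<exists>U W X c e. 1 \<le> 0 * (n * 16 + 8 + K) + e * K + 1 \<and>
    rep s n inp U W X c m \<and> lat_basis U W D e \<and> (\<forall>j'<0. gen n U (\<lambda>_. 0) (vct j')))"
    using assms by auto
qed (use assms in \<open>auto simp: sizes_def\<close>)

lemma wp_Basis_Program: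
  fixes B :: real
  assumes "sizes s n r" "rep s n inp (\<lambda>_ _. 0) (\<lambda>_ _. 0) (\<lambda>_. 0) (\<lambda>_. 0) m"
    and bound: "\<And>j i. j < s \<Longrightarrow> i < n \<Longrightarrow> \<bar>vct j i\<bar> \<le> B" and "1 \<le> n"
  shows "wp Basis_Program r m (\<lambda>t r' m'. \<exists>U W e. n \<le> s \<and> t \<le> 1000 * (s * n^2 + n^2 * e) \<and>
    lat_basis U W ((real n * B) ^ n) e \<and> (\<forall>j<s. gen n U (\<lambda>_. 0) (vct j)) \<and>
    (\<forall>k<n. \<forall>i<n. m' (k * n + i) = U k i))"
  unfolding Basis_Program_def
  apply simp
  apply (rule wp_mono[OF wp_Init[OF assms(1,2)]])
  apply (elim conjE exE)
  subgoal premises prems1 for t1 r1 m1 U1 W1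
  proof -
    note r1 = agree_sizes[OF assms(1) prems1(2), simplified]
    show ?thesis
      apply (rule wp_mono[OF wp_Collect_Basis[OF r1 prems1(3,4)]])
      apply (elim conjE exE)
      subgoal premises prems2 for t2 r2 m2 U2 W2 X2 c2
      proof -
        note r2 = agree_sizes[OF r1 prems2(2), simplified]
        obtain h where h: "\<And>k. k < n \<Longrightarrow> h k < s \<and> U2 k = vct (h k)"
          using prems2(5) by metis
        \<comment> \<open>Distinct basis vectors come from distinct generators, since two equal ones
          would give 0 = 1 by duality. Counting then yields n \<le> s.\<close>
        have "inj_on h {..<n}"
        proof (rule inj_onI)
          fix k l assume *: "k \<in> {..<n}" "l \<in> {..<n}" "h k = h l"
          then have "U2 k = U2 l"
            using h by auto
          then show "k = l"
            using prems2(4) * unfolding dual_def by (metis lessThan_iff zero_neq_one)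
        qed
        then have ns: "n \<le> s"
          using card_inj_on_le[of h "{..<n}" "{..<s}"] h by auto
        have "\<bar>det (col_mat n U2)\<bar> \<le> (real n * B) ^ n"
          using h bound by (intro abs_det_le) auto
        then have "lat_basis U2 W2 ((real n * B) ^ n) 0"
          using h lat_gen prems2(4) by (auto simp: lat_basis_def)
        then show ?thesis
          apply (intro wp_mono[OF wp_Insert_All[OF r2 prems2(3)]])
           apply assumption
          apply (elim conjE exE)
          subgoal premises prems3 for t3 r3 m3 U3 W3 X3 c3 e
          proof -
            note r3 = agree_sizes[OF r2 prems3(2), simplified]
            show ?thesis
              apply (rule wp_mono[OF wp_Write_Output[OF r3 prems3(4) ns]])
              subgoal premises prems4 for t4 r4 m4
              proof -
                have "t1 + (t2 + (t3 + t4)) \<le> 1000 * (s * n^2 + n^2 * e)"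
                  using total_time[OF \<open>1 \<le> n\<close> ns prems1(1) prems2(1) prems3(3) conjunct1[OF prems4]] .
                then show ?thesis
                  using prems3(5,6) conjunct2[OF prems4]
                  by (intro conjI[OF ns]) (rule exI[of _ U3], rule exI[of _ W3], rule exI[of _ e], simp)
              qed
              done
          qed
          done
      qed
      done
  qed
  done

end

section \<open>Lattices\<close>

lemma mat_of_cols_mult_vec:
  "mat_of_cols n vs *\<^sub>v vec (length vs) c = vec n (\<lambda>i. \<Sum>k<length vs. vs ! k $ i * c k)"
  by (auto simp: vec_eq_iff scalar_prod_def mat_of_cols_def lessThan_atLeast0)

lemma int_span_iff:
  "x \<in> int_span n vs \<longleftrightarrow> (\<exists>c :: nat \<Rightarrow> int. x = vec n (\<lambda>i. \<Sum>k<length vs. vs ! k $ i * of_int (c k)))"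
  by (simp add: int_span_def mat_of_cols_mult_vec)

lemma int_span_diff:
  assumes "vec n f \<in> int_span n vs" "vec n g \<in> int_span n vs"
  shows "vec n (\<lambda>i. f i - g i * of_int z) \<in> int_span n vs"
proof -
  obtain c d :: "nat \<Rightarrow> int"
    where "vec n f = vec n (\<lambda>i. \<Sum>k<length vs. vs ! k $ i * of_int (c k))"
      and "vec n g = vec n (\<lambda>i. \<Sum>k<length vs. vs ! k $ i * of_int (d k))"
    using assms unfolding int_span_iff by blast
  then have "vec n (\<lambda>i. f i - g i * of_int z) =
      vec n (\<lambda>i. \<Sum>k<length vs. vs ! k $ i * of_int (c k - d k * z))"
    by (simp add: vec_eq_iff algebra_simps sum_subtractf sum_distrib_left)
  then show ?thesis
    unfolding int_span_iff by (rule exI[of _ "\<lambda>k. c k - d k * z"])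
qed

lemma nth_in_int_span:
  assumes "set vs \<subseteq> carrier_vec n" "j < length vs"
  shows "vs ! j \<in> int_span n vs"
  unfolding int_span_iff
proof
  have "vs ! j \<in> carrier_vec n"
    using assms by auto
  moreover have "(\<Sum>k<length vs. vs ! k $ i * of_int (if k = j then 1 else 0)) = vs ! j $ i" for i
    using assms(2) by (simp add: if_distrib[of "\<lambda>x. _ * of_int x"] cong: if_cong)
  ultimately show "vs ! j = vec n (\<lambda>i. \<Sum>k<length vs. vs ! k $ i * of_int (if k = j then 1 else 0))"
    by auto
qed

lemma span_orthogonal:
  fixes w :: "real vec"
  assumes "w \<in> carrier_vec n" "L \<subseteq> carrier_vec n" "\<forall>y\<in>L. w \<bullet> y = 0" "x \<in> real_span n L"
  shows "w \<bullet> x = 0"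
proof -
  interpret vec_space "TYPE(real)" n .
  have "w \<in> orthogonal_complement L"
    using assms(1,3) by (simp add: orthogonal_complement_def)
  then have "w \<in> orthogonal_complement (span L)"
    by (simp only: in_orthogonal_complement_span[OF assms(2)])
  then show ?thesis
    using assms(4) by (simp add: orthogonal_complement_def)
qed

lemma abs_index_le_vnorm:
  assumes "x \<in> carrier_vec n" "i < n"
  shows "\<bar>x $ i\<bar> \<le> vnorm x"
proof -
  have "(x $ i)\<^sup>2 \<le> (\<Sum>j<n. (x $ j)\<^sup>2)"
    using assms(2) by (intro member_le_sum) auto
  also have "\<dots> = x \<bullet> x"
    using assms(1) by (auto simp: scalar_prod_def power2_eq_square lessThan_atLeast0)
  finally have "sqrt ((x $ i)\<^sup>2) \<le> sqrt (x \<bullet> x)"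
    by (rule real_sqrt_le_mono)
  then show ?thesis
    by (simp add: vnorm_def)
qed

context generators
begin

text \<open>Independence follows from the left inverse W. For the spans, each \<open>U k\<close>
  lies in the lattice, and conversely every generator is an integer combination of U.\<close>

lemma lattice_basis_map:
  assumes U: "dual n U W" "\<And>k. k < n \<Longrightarrow> lat (U k)" and gen: "\<And>j. j < s \<Longrightarrow> gen n U (\<lambda>_. 0) (vct j)"
    and vs: "length vs = s" "set vs \<subseteq> carrier_vec n" "\<And>j i. j < s \<Longrightarrow> i < n \<Longrightarrow> vct j i = vs ! j $ i"
    and lat: "lat = (\<lambda>f. vec n f \<in> int_span n vs)"
  shows "lattice_basis n (int_span n vs) (map (\<lambda>k. vec n (U k)) [0..<n])"
  unfolding lattice_basis_def
proof (intro conjI ballI impI)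
  let ?bs = "map (\<lambda>k. vec n (U k)) [0..<n]"
  show "set ?bs \<subseteq> carrier_vec n"
    by auto
  show "c = 0\<^sub>v (length ?bs)" if c: "c \<in> carrier_vec (length ?bs)" "mat_of_cols n ?bs *\<^sub>v c = 0\<^sub>v n" for c
  proof -
    have "mat_of_cols n ?bs = col_mat n U"
      by (auto simp: mat_eq_iff mat_of_cols_def)
    moreover have "transpose_mat (col_mat n W) *\<^sub>v 0\<^sub>v n = 0\<^sub>v n"
      by (intro eq_vecI) simp_all
    ultimately have "transpose_mat (col_mat n W) *\<^sub>v (col_mat n U *\<^sub>v c) = 0\<^sub>v n"
      using c(2) by simp
    moreover have "transpose_mat (col_mat n W) *\<^sub>v (col_mat n U *\<^sub>v c) = c"
      using U(1)[unfolded dual_iff] c(1) by (subst assoc_mult_mat_vec[symmetric, of _ n n _ n]) auto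
    ultimately show ?thesis
      by simp
  qed
  show "int_span n ?bs = int_span n vs"
  proof (intro equalityI subsetI)
    fix x assume "x \<in> int_span n ?bs"
    then obtain c :: "nat \<Rightarrow> int" where x: "x = vec n (\<lambda>i. \<Sum>k<n. ?bs ! k $ i * of_int (c k))"
      by (auto simp: int_span_iff)
    have "vec n (\<lambda>_. 0) \<in> int_span n vs"
      unfolding int_span_iff by (rule exI[of _ "\<lambda>_. 0"]) simp
    \<comment> \<open>\<open>lat_sum\<close> subtracts, so the combination is written as zero minus
      its negative.\<close>
    then have "lat (\<lambda>i. 0 - (\<Sum>k<n. U k i * of_int (- c k)))"
      using U(2) lat by (intro lat_sum) auto
    moreover have "vec n (\<lambda>i. 0 - (\<Sum>k<n. U k i * of_int (- c k))) = x"
      unfolding x by (auto simp: sum_negf)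
    ultimately show "x \<in> int_span n vs"
      using lat by simp
  next
    fix x assume "x \<in> int_span n vs"
    then obtain c :: "nat \<Rightarrow> int" where x: "x = vec n (\<lambda>i. \<Sum>j<s. vs ! j $ i * of_int (c j))"
      using vs(1) by (auto simp: int_span_iff)
    obtain y :: "nat \<Rightarrow> nat \<Rightarrow> int" where y: "\<And>j i. j < s \<Longrightarrow> i < n \<Longrightarrow> vct j i = (\<Sum>k<n. U k i * of_int (y j k))"
      using gen unfolding gen_def by simp metis
    have "(\<Sum>j<s. vs ! j $ i * of_int (c j)) = (\<Sum>k<n. U k i * of_int (\<Sum>j<s. y j k * c j))" if "i < n" for i
    proof -
      have "(\<Sum>j<s. vs ! j $ i * of_int (c j)) = (\<Sum>j<s. (\<Sum>k<n. U k i * of_int (y j k)) * of_int (c j))"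
        using vs(3)[OF _ that] y[OF _ that] by (intro sum.cong) auto
      also have "\<dots> = (\<Sum>k<n. U k i * of_int (\<Sum>j<s. y j k * c j))"
        unfolding of_int_sum sum_distrib_left sum_distrib_right by (subst sum.swap) (simp add: mult.assoc)
      finally show ?thesis .
    qed
    then have "x = vec n (\<lambda>i. \<Sum>k<n. ?bs ! k $ i * of_int (\<Sum>j<s. y j k * c j))"
      unfolding x by auto
    then show "x \<in> int_span n ?bs"
      unfolding int_span_iff by (intro exI[of _ "\<lambda>k. \<Sum>j<s. y j k * c j"]) simp
  qed
qed

end

text \<open>For \<open>full\<close>: a dual vector \<open>W k\<close> orthogonal to all generators
  is orthogonal to L and to its real span, which is the whole space; but its product with
  \<open>U k\<close> is 1.\<close>

lemma generators_input:
  assumes L: "integral_lattice n L" "full_rank n L" and vs: "set vs \<subseteq> carrier_vec n" "int_span n vs = L"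
  shows "generators n (length vs) (snd (input_state n vs)) (\<lambda>f. vec n f \<in> L)"
proof
  let ?s = "length vs"
  let ?v = "\<lambda>j i. snd (input_state n vs) (j * n + i)"
  have v: "vec n (?v j) = vs ! j" if "j < ?s" for j
  proof (rule eq_vecI)
    have "dim_vec (vs ! j) = n"
      by (rule carrier_vecD[OF subsetD[OF vs(1) nth_mem[OF that]]])
    then show "vec n (?v j) $ i = vs ! j $ i" if "i < dim_vec (vs ! j)" for i
      using that less_mult_add[OF \<open>j < ?s\<close>, of i n] by (simp add: input_state_def)
    show "dim_vec (vec n (?v j)) = dim_vec (vs ! j)"
      using \<open>dim_vec (vs ! j) = n\<close> by simp
  qed
  show "vec n (?v j) \<in> L" if "j < ?s" for j
    using nth_in_int_span[OF vs(1) that] v[OF that] vs(2) by simp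
  show "(\<Sum>i<n. f i * g i) \<in> \<int>" if "vec n f \<in> L" "vec n g \<in> L" for f g
  proof -
    have "vec n f \<bullet> vec n g \<in> \<int>"
      using L(1) that by (simp add: integral_lattice_def)
    then show ?thesis
      by (simp add: scalar_prod_def lessThan_atLeast0)
  qed
  show "vec n (\<lambda>i. f i - g i * of_int z) \<in> L" if "vec n f \<in> L" "vec n g \<in> L" for f g z
    using int_span_diff that vs(2) by blast
  show "\<exists>j<?s. mult_vec n W (?v j) k \<noteq> 0" if "dual n U W" "k < n" for U W k
  proof (rule ccontr)
    assume *: "\<not> ?thesis"
    let ?w = "vec n (W k)"
    have mult: "?w \<bullet> vec n X = mult_vec n W X k" for X
      by (simp add: scalar_prod_def mult_vec_def lessThan_atLeast0)
    have "?w \<bullet> x = 0" if x: "x \<in> L" for x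
    proof -
      obtain c :: "nat \<Rightarrow> int" where "x = vec n (\<lambda>i. \<Sum>j<?s. vs ! j $ i * of_int (c j))"
        using x vs(2) int_span_iff by blast
      then have "?w \<bullet> x = (\<Sum>i<n. W k i * (\<Sum>j<?s. vs ! j $ i * of_int (c j)))"
        by (simp add: mult mult_vec_def)
      also have "\<dots> = (\<Sum>j<?s. of_int (c j) * mult_vec n W (\<lambda>i. vs ! j $ i) k)"
        unfolding mult_vec_def sum_distrib_left by (subst sum.swap) (simp add: ac_simps)
      also have "\<dots> = (\<Sum>j<?s. of_int (c j) * mult_vec n W (?v j) k)"
        by (rule sum.cong) (auto simp flip: v simp: mult_vec_def)
      finally show ?thesis
        using * by simp
    qed
    moreover have "L \<subseteq> carrier_vec n"
      using vs(2) by (auto simp: int_span_iff)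
    moreover have "vec n (U k) \<in> real_span n L"
      using L(2) by (simp add: full_rank_def)
    ultimately have "?w \<bullet> vec n (U k) = 0"
      by (intro span_orthogonal[of _ n L]) auto
    then show False
      using that by (simp add: mult dual_def)
  qed
qed

text \<open>Taking logarithms gives e \<le> 2 n ln (n B). The squared logarithm then comes from 2 y
  \<le> y^2 + 1 with y = n^3 ln (n B), and the 1 is absorbed by s n^2.\<close>

lemma exponent_bound:
  assumes "2 ^ e \<le> (real n * B) ^ n" "0 \<le> B" "1 \<le> n" "1 \<le> s"
  shows "real n ^ 2 * real e \<le> real n ^ 6 * (ln (real n * B))\<^sup>2 + real s * real n ^ 2"
proof -
  let ?x = "ln (real n * B)"
  have "0 < real n * B"
  proof (rule ccontr)
    assume "\<not> ?thesis"
    then have "real n * B = 0"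
      using assms(2) by (metis mult_nonneg_nonneg of_nat_0_le_iff less_eq_real_def)
    then have "(2 :: real) ^ e \<le> 0"
      using assms(1,3) by (simp add: power_0_left)
    then show False
      using zero_less_power[of "2 :: real" e] by linarith
  qed
  then have "real e * ln 2 \<le> real n * ?x"
    using assms(1) by (subst (asm) ln_le_cancel_iff[symmetric]) (simp_all add: ln_realpow)
  \<comment> \<open>The inequality ln x \<le> x - 1 at x = 1/2 gives ln 2 \<ge> 1/2.\<close>
  moreover have "real e * (1 / 2) \<le> real e * ln 2"
    using ln_le_minus_one[of "1 / 2 :: real"] by (intro mult_left_mono) (simp_all add: ln_div)
  ultimately have "real e \<le> 2 * (real n * ?x)"
    by simp
  then have "real n ^ 2 * real e \<le> real n ^ 2 * (2 * (real n * ?x))"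
    by (rule mult_left_mono) simp
  also have "\<dots> = 2 * (real n ^ 3 * ?x)"
    by (simp add: power2_eq_square power3_eq_cube)
  also have "\<dots> \<le> (real n ^ 3 * ?x)\<^sup>2 + 1"
    using zero_le_power2[of "real n ^ 3 * ?x - 1"] by (simp add: power2_diff)
  also have "\<dots> = real n ^ 6 * ?x\<^sup>2 + 1 * 1"
    by (simp add: power_mult_distrib flip: power_mult)
  also have "\<dots> \<le> real n ^ 6 * ?x\<^sup>2 + real s * real n ^ 2"
    using assms(3,4) by (intro add_left_mono mult_mono) simp_all
  finally show ?thesis .
qed

theorem mainTheorem3:
  shows "\<exists>(P :: prog) (C :: real).
    \<forall>(n :: nat) (s :: nat) (B :: real) (L :: real vec set) (vs :: real vec list).
      1 \<le> n \<longrightarrow> integral_lattice n L \<longrightarrow> full_rank n L \<longrightarrow>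
      length vs = s \<longrightarrow> set vs \<subseteq> carrier_vec n \<longrightarrow> int_span n vs = L \<longrightarrow>
      (\<forall>v\<in>set vs. vnorm v \<le> B) \<longrightarrow>
      (\<exists>t \<sigma> bs.
         exec P (input_state n vs) t \<sigma> \<and>
         length bs = n \<and> outputs n \<sigma> bs \<and> lattice_basis n L bs \<and>
         real t \<le> C * (real n ^ 6 * (ln (real n * B))\<^sup>2 + real s * real n ^ 2))"
proof (intro exI[of _ Basis_Program] exI[of _ "2000 :: real"] allI impI)
  fix n s :: nat and B L vs
  assume n: "1 \<le> n" and L: "integral_lattice n L" "full_rank n L" and len: "length vs = s"
    and vs: "set vs \<subseteq> carrier_vec n" "int_span n vs = L" and B: "\<forall>v\<in>set vs. vnorm v \<le> B"
  define inp where "inp = snd (input_state n vs)"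
  define r where "r = fst (input_state n vs)"
  interpret generators n s inp "\<lambda>f. vec n f \<in> L"
    using generators_input[OF L vs] len by (simp add: inp_def)
  have v: "vct j i = vs ! j $ i" if "j < s" "i < n" for j i
    using that less_mult_add[OF that] len by (simp add: inp_def input_state_def)
  \<comment> \<open>Memory behind the input is zero, which is the state of zero arrays that
    \<open>wp_Init\<close> starts from.\<close>
  have "sizes s n r" and "rep s n inp (\<lambda>_ _. 0) (\<lambda>_ _. 0) (\<lambda>_. 0) (\<lambda>_. 0) inp"
    using len by (auto simp: r_def inp_def input_state_def sizes_def rep_def loc_def)
  moreover have bound: "\<bar>vct j i\<bar> \<le> B" if "j < s" "i < n" for j i
  proof -
    have "vs ! j \<in> set vs"
      using that len by simp
    then show ?thesis
      using abs_index_le_vnorm[of "vs ! j" n i] vs(1) B v[OF that] that(2) by fastforce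
  qed
  ultimately have "wp Basis_Program r inp (\<lambda>t r' m'. \<exists>U W e. n \<le> s \<and> t \<le> 1000 * (s * n^2 + n^2 * e) \<and>
    lat_basis U W ((real n * B) ^ n) e \<and> (\<forall>j<s. gen n U (\<lambda>_. 0) (vct j)) \<and>
    (\<forall>k<n. \<forall>i<n. m' (k * n + i) = U k i))"
    using n by (rule wp_Basis_Program)
  then obtain t r' m' U W e where P: "exec Basis_Program (r, inp) t (r', m')" and "n \<le> s"
    and t: "t \<le> 1000 * (s * n^2 + n^2 * e)" and U: "lat_basis U W ((real n * B) ^ n) e"
    and gen: "\<forall>j<s. gen n U (\<lambda>_. 0) (vct j)" and out: "\<forall>k<n. \<forall>i<n. m' (k * n + i) = U k i"
    unfolding wp_def by (elim exE conjE) (rule that)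
  let ?bs = "map (\<lambda>k. vec n (U k)) [0..<n]"
  have "lattice_basis n L ?bs"
    using lattice_basis_map[of U W vs] U gen len vs v by (simp add: lat_basis_def)
  moreover have "outputs n (r', m') ?bs"
    using out by (simp add: outputs_def)
  moreover have "exec Basis_Program (input_state n vs) t (r', m')"
    using P by (simp add: r_def inp_def)
  \<comment> \<open>After n^2 e is estimated by \<open>exponent_bound\<close>, the term s n^2 occurs
    twice, which doubles the constant 1000.\<close>
  moreover have "real t \<le> 2000 * (real n ^ 6 * (ln (real n * B))\<^sup>2 + real s * real n ^ 2)"
  proof -
    \<comment> \<open>By n \<le> s there is at least one generator, and the absolute value of its
      first coordinate is at most B.\<close>
    have "0 \<le> B"
      using bound[of 0 0] n \<open>n \<le> s\<close> by linarith
    then have "real n ^ 2 * real e \<le> real n ^ 6 * (ln (real n * B))\<^sup>2 + real s * real n ^ 2"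
      using exponent_bound[OF lat_basis_bound[OF U]] n \<open>n \<le> s\<close> by simp
    moreover have "real t \<le> 1000 * (real s * real n ^ 2 + real n ^ 2 * real e)"
      using of_nat_mono[OF t, where 'a = real] by simp
    moreover have "0 \<le> real n ^ 6 * (ln (real n * B))\<^sup>2"
      by simp
    ultimately show ?thesis
      by argo
  qed
  ultimately show "\<exists>t \<sigma> bs. exec Basis_Program (input_state n vs) t \<sigma> \<and>
         length bs = n \<and> outputs n \<sigma> bs \<and> lattice_basis n L bs \<and>
         real t \<le> 2000 * (real n ^ 6 * (ln (real n * B))\<^sup>2 + real s * real n ^ 2)"
    by (intro exI[of _ t] exI[of _ "(r', m')"] exI[of _ ?bs]) simp
qed

end
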